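(* Let $\kappa$ be an infinite field, and let $\mathscr M$ be a matricube with ground set $Q_\varrho=\prod_{j=1}^m\{0,1,\dots,\varrho_j\}$, where $m\ge1$ and $\varrho_1,\dots,\varrho_m$ are non-negative integers. Then $\mathscr M$ is representable over $\kappa$ if and only if the natural matroid of $\mathscr M$ is representable over $\kappa$.
   Context: $Q_\varrho$ is ordered coordinatewise: $x\preceq y$ iff $x_j\le y_j$ for all $j$. The operations $\vee$ and $\wedge$ are the coordinatewise maximum and minimum. $e_i$ is the $i$-th unit vector. A matricube with ground set $Q_\varrho$ is given by a function $\mathbf r:Q_\varrho\to\mathbb Z$ (its rank function) such that: (R1) $\mathbf r(0)=0$ and $\mathbf r(t\,e_i)-\mathbf r((t-1)e_i)\le 1$ for all $1\le i\le m$ and $1\le t\le \varrho_i$; (R2) $x\preceq y$ implies $\mathbf r(x)\le\mathbf r(y)$; (R3) $\mathbf r(x)+\mathbf r(y)\ge \mathbf r(x\vee y)+\mathbf r(x\wedge y)$ for all $x,y\in Q_\varrho$. Representability. An initial (decreasing) flag of length $s$ in a finite-dimensional $\kappa$-vector space $H$ is a chain of subspaces $H=F^0\supseteq F^1\supseteq\dots\supseteq F^s\supsetneq(0)$ with each $F^i$ of codimension $0$ or $1$ in $F^{i-1}$. $\mathscr M$ is representable over $\kappa$ if there are a finite-dimensional $\kappa$-vector space $H$ and initial flags $F_1^\bullet,\dots,F_m^\bullet$ in $H$ of lengths $\varrho_1,\dots,\varrho_m$ such that $\mathbf r(x)=\mathrm{codim}_\kappa\bigl(F_1^{x_1}\cap\dots\cap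 F_m^{x_m}\bigr)$ for all $x\in Q_\varrho$. A matroid is representable over $\kappa$ if it is the matroid of linear (in)dependence of a family of vectors in a $\kappa$-vector space indexed by its ground set. Natural matroid. Let $E=\bigsqcup_{i=1}^m\{0,1,\dots,\varrho_i\}$ (disjoint union), where the element $t$ of the $i$-th set is identified with the point $t\,e_i\in Q_\varrho$. The natural polymatroid of $\mathscr M$ is the integer polymatroid on $E$ with rank function $\rho(S)=\mathbf r\bigl(\bigvee_{a\in S}a\bigr)$ for $S\subseteq E$ (join taken in $Q_\varrho$; the empty join is $0$). Replace each $e\in E$ by $\rho(\{e\})$ distinct elements, and let $\widehat E$ be the resulting set; for $S\subseteq E$, let $\widehat S\subseteq\widehat E$ be the union of the elements associated with the $e\in S$. The natural matroid of $\mathscr M$ is the matroid on $\widehat E$ with rank function $\widehat\rho(Y)=\min_{S\subseteq E}\bigl(\rho(S)+|Y\setminus\widehat S|\bigr)$. *)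

theory Defs
  imports Complex_Main "HOL-Library.Function_Algebras"
begin

section \<open>Matricubes\<close>

text \<open>
  Points of the hypercuboid with side lengths \<open>\<rho> 1, \<dots>, \<rho> m\<close> are encoded as functions
  \<open>nat \<Rightarrow> nat\<close> vanishing outside \<open>{1..m}\<close>.  The coordinatewise order, maximum and minimum are
  then the pointwise \<open>\<le>\<close>, \<open>sup\<close> and \<open>inf\<close> of the function type.
\<close>

definition hypercuboid :: "nat \<Rightarrow> (nat \<Rightarrow> nat) \<Rightarrow> (nat \<Rightarrow> nat) set" where
  "hypercuboid m \<rho> = {x. (\<forall>j\<in>{1..m}. x j \<le> \<rho> j) \<and> (\<forall>j. j \<notin> {1..m} \<longrightarrow> x j = 0)}"

text \<open>\<open>axis_point i t\<close> is the point \<open>t e\<^sub>i\<close>.\<close>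

definition axis_point :: "nat \<Rightarrow> nat \<Rightarrow> nat \<Rightarrow> nat" where
  "axis_point i t = (\<lambda>j. if j = i then t else 0)"

text \<open>The rank function is total in HOL; only its values on the hypercuboid matter.\<close>

locale matricube =
  fixes m :: nat and \<rho> :: "nat \<Rightarrow> nat" and r :: "(nat \<Rightarrow> nat) \<Rightarrow> int"
  assumes rank_zero: "r (\<lambda>_. 0) = 0"
    and rank_step: "\<And>i t. \<lbrakk>i \<in> {1..m}; t \<in> {1..\<rho> i}\<rbrakk> \<Longrightarrow>
          r (axis_point i t) - r (axis_point i (t - 1)) \<le> 1"
    and rank_mono: "\<And>x y. \<lbrakk>x \<in> hypercuboid m \<rho>; y \<in> hypercuboid m \<rho>; x \<le> y\<rbrakk> \<Longrightarrow> r x \<le> r y"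
    and rank_submodular: "\<And>x y. \<lbrakk>x \<in> hypercuboid m \<rho>; y \<in> hypercuboid m \<rho>\<rbrakk> \<Longrightarrow>
          r (sup x y) + r (inf x y) \<le> r x + r y"


section \<open>Representations in a given vector space\<close>

definition findim_subspace :: "('k::field \<Rightarrow> 'v::ab_group_add \<Rightarrow> 'v) \<Rightarrow> 'v set \<Rightarrow> bool" where
  "findim_subspace scale H \<longleftrightarrow> (\<exists>B. finite B \<and> module.span scale B = H)"

text \<open>Codimension of a subspace \<open>U\<close> of the finite-dimensional space \<open>H\<close>.\<close>

definition codim :: "('k::field \<Rightarrow> 'v::ab_group_add \<Rightarrow> 'v) \<Rightarrow> 'v set \<Rightarrow> 'v set \<Rightarrow> int" where
  "codim scale H U = int (vector_space.dim scale H) - int (vector_space.dim scale U)"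

definition initial_flag ::
  "('k::field \<Rightarrow> 'v::ab_group_add \<Rightarrow> 'v) \<Rightarrow> 'v set \<Rightarrow> nat \<Rightarrow> (nat \<Rightarrow> 'v set) \<Rightarrow> bool" where
  "initial_flag scale H s F \<longleftrightarrow>
     F 0 = H \<and> (\<forall>t\<le>s. module.subspace scale (F t)) \<and>
     (\<forall>t\<in>{1..s}. F t \<subseteq> F (t - 1) \<and> codim scale (F (t - 1)) (F t) \<in> {0, 1}) \<and>
     {0} \<subset> F s"

definition flag_representation ::
  "('k::field \<Rightarrow> 'v::ab_group_add \<Rightarrow> 'v) \<Rightarrow> nat \<Rightarrow> (nat \<Rightarrow> nat) \<Rightarrow> ((nat \<Rightarrow> nat) \<Rightarrow> int) \<Rightarrow>
   'v set \<Rightarrow> (nat \<Rightarrow> nat \<Rightarrow> 'v set) \<Rightarrow> bool" where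
  "flag_representation scale m \<rho> r H F \<longleftrightarrow>
     findim_subspace scale H \<and> (\<forall>i\<in>{1..m}. initial_flag scale H (\<rho> i) (F i)) \<and>
     (\<forall>x\<in>hypercuboid m \<rho>. r x = codim scale H (\<Inter>i\<in>{1..m}. F i (x i)))"

text \<open>Injectivity: a family with a repeated vector is dependent.\<close>

definition independent_family ::
  "('k::field \<Rightarrow> 'v::ab_group_add \<Rightarrow> 'v) \<Rightarrow> ('e \<Rightarrow> 'v) \<Rightarrow> 'e set \<Rightarrow> bool" where
  "independent_family scale v Y \<longleftrightarrow> inj_on v Y \<and> \<not> module.dependent scale (v ` Y)"

text \<open>
  A matroid is given by its ground set \<open>E\<close> and its rank function \<open>rk\<close>; its independent sets
  are those \<open>Y \<subseteq> E\<close> with \<open>rk Y = |Y|\<close>.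
\<close>

definition vector_representation ::
  "('k::field \<Rightarrow> 'v::ab_group_add \<Rightarrow> 'v) \<Rightarrow> 'e set \<Rightarrow> ('e set \<Rightarrow> int) \<Rightarrow> ('e \<Rightarrow> 'v) \<Rightarrow> bool" where
  "vector_representation scale E rk v \<longleftrightarrow>
     (\<forall>Y. Y \<subseteq> E \<longrightarrow> (rk Y = int (card Y) \<longleftrightarrow> independent_family scale v Y))"


section \<open>Representability over a field\<close>

text \<open>
  HOL cannot quantify existentially over types, so the vector space asked for in the definition
  of representability is sought inside the space of all sequences over the field.  Nothing is
  lost, since this space contains a copy of every finite-dimensional vector space: see
  \<open>matricube_representableI\<close> and \<open>matroid_representableI\<close> below.
\<close>

definition seq_scale :: "'k::field \<Rightarrow> (nat \<Rightarrow> 'k) \<Rightarrow> (nat \<Rightarrow> 'k)" where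
  "seq_scale c f = (\<lambda>n. c * f n)"

global_interpretation seq: vector_space "seq_scale :: 'k::field \<Rightarrow> _"
  by unfold_locales (auto simp: seq_scale_def fun_eq_iff algebra_simps)

definition matricube_representable ::
  "'k::field itself \<Rightarrow> nat \<Rightarrow> (nat \<Rightarrow> nat) \<Rightarrow> ((nat \<Rightarrow> nat) \<Rightarrow> int) \<Rightarrow> bool" where
  "matricube_representable _ m \<rho> r \<longleftrightarrow>
     (\<exists>H F. flag_representation (seq_scale :: 'k \<Rightarrow> _) m \<rho> r H F)"

definition matroid_representable :: "'k::field itself \<Rightarrow> 'e set \<Rightarrow> ('e set \<Rightarrow> int) \<Rightarrow> bool" where
  "matroid_representable _ E rk \<longleftrightarrow>
     (\<exists>v. vector_representation (seq_scale :: 'k \<Rightarrow> _) E rk v)"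


section \<open>The natural matroid\<close>

text \<open>The pair \<open>(i, t)\<close> is the element \<open>t\<close> of the \<open>i\<close>-th set of the disjoint union.\<close>

definition polymatroid_ground :: "nat \<Rightarrow> (nat \<Rightarrow> nat) \<Rightarrow> (nat \<times> nat) set" where
  "polymatroid_ground m \<rho> = (SIGMA i:{1..m}. {0..\<rho> i})"

text \<open>The zero point is inserted to account for the empty join; it is neutral for \<open>sup\<close>.\<close>

definition join :: "(nat \<times> nat) set \<Rightarrow> nat \<Rightarrow> nat" where
  "join S = Sup_fin (insert (\<lambda>_. 0) ((\<lambda>(i, t). axis_point i t) ` S))"

definition polymatroid_rank :: "((nat \<Rightarrow> nat) \<Rightarrow> int) \<Rightarrow> (nat \<times> nat) set \<Rightarrow> int" where
  "polymatroid_rank r S = r (join S)"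

text \<open>
  \<open>blow_up r S\<close> consists of \<open>polymatroid_rank r {e}\<close> copies \<open>(e, 0), (e, 1), \<dots>\<close> of each
  \<open>e \<in> S\<close>.
\<close>

definition blow_up :: "((nat \<Rightarrow> nat) \<Rightarrow> int) \<Rightarrow> (nat \<times> nat) set \<Rightarrow> ((nat \<times> nat) \<times> nat) set" where
  "blow_up r S = (SIGMA e:S. {..<nat (polymatroid_rank r {e})})"

definition natural_ground ::
  "nat \<Rightarrow> (nat \<Rightarrow> nat) \<Rightarrow> ((nat \<Rightarrow> nat) \<Rightarrow> int) \<Rightarrow> ((nat \<times> nat) \<times> nat) set" where
  "natural_ground m \<rho> r = blow_up r (polymatroid_ground m \<rho>)"

definition natural_rank ::
  "nat \<Rightarrow> (nat \<Rightarrow> nat) \<Rightarrow> ((nat \<Rightarrow> nat) \<Rightarrow> int) \<Rightarrow> ((nat \<times> nat) \<times> nat) set \<Rightarrow> int" where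
  "natural_rank m \<rho> r Y =
     (MIN S\<in>Pow (polymatroid_ground m \<rho>). polymatroid_rank r S + int (card (Y - blow_up r S)))"


section \<open>Adequacy of the definitions\<close>

lemma linear_embedding_exists:
  fixes scale :: "'k::field \<Rightarrow> 'v::ab_group_add \<Rightarrow> 'v"
  assumes "vector_space scale" and "findim_subspace scale H"
  obtains \<phi> where "Vector_Spaces.linear scale seq_scale \<phi>" "inj_on \<phi> H"
proof -
  interpret V: vector_space scale by fact
  obtain B0 where B0: "finite B0" "V.span B0 = H"
    using assms(2) unfolding findim_subspace_def by auto
  obtain B where B': "B \<subseteq> B0" "V.independent B" "B0 \<subseteq> V.span B"
    by (rule V.maximal_independent_subset[of B0])
  then have "V.span B = H"
    using B0 V.span_mono[of B B0] V.span_minimal[OF B'(3) V.subspace_span] by auto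
  note B = B'(1,2) this
  define E where "E = V.extend_basis B"
  have E: "V.independent E" "V.span E = UNIV" "B \<subseteq> E"
    using V.extend_basis_superset[OF B(2)] V.independent_extend_basis[OF B(2)]
      V.span_extend_basis[OF B(2)] by (simp_all add: E_def)
  have "finite B" using B B0 finite_subset by blast
  then obtain e where e: "bij_betw e {0..<card B} B"
    using ex_bij_betw_nat_finite by blast
  define \<phi> where "\<phi> x = (\<lambda>n. if n < card B then V.representation E x (e n) else 0)" for x
  have lin: "Vector_Spaces.linear scale seq_scale \<phi>"
    by unfold_locales
       (auto simp: \<phi>_def fun_eq_iff seq_scale_def E V.representation_add V.representation_scale)
  moreover have "inj_on \<phi> H"
  proof (rule inj_onI)
    fix x y assume xy: "x \<in> H" "y \<in> H" "\<phi> x = \<phi> y"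
    have rep: "V.representation E z = V.representation B z" if "z \<in> H" for z
      using V.representation_extend[OF E(1) _ E(3), of z] that B(3) by simp
    have "V.representation B x b = V.representation B y b" for b
    proof (cases "b \<in> B")
      case True
      then have "b \<in> e ` {0..<card B}"
        using e by (simp add: bij_betw_def)
      then obtain n where "n < card B" "e n = b" by auto
      moreover have "\<phi> x n = \<phi> y n" using xy(3) by simp
      ultimately show ?thesis
        using rep[OF xy(1)] rep[OF xy(2)] by (simp add: \<phi>_def)
    next
      case False
      have "V.representation B w b = 0" for w
      proof (rule ccontr)
        assume "V.representation B w b \<noteq> 0"
        then have "b \<in> B" by (rule V.representation_ne_zero)
        with False show False ..
      qed
      then show ?thesis by (simp only:)
    qed
    then have "V.representation B x = V.representation B y" by (rule ext)
    moreover have "(\<Sum>b\<in>B. scale (V.representation B z b) b) = z" if "z \<in> H" for z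
      by (rule V.sum_representation_eq[OF B(2) _ \<open>finite B\<close> order_refl]) (use that B(3) in simp)
    ultimately show "x = y"
      using xy(1,2) by metis
  qed
  ultimately show ?thesis using that by blast
qed

lemma dim_image_inj:
  assumes "Vector_Spaces.linear s1 s2 \<phi>" "findim_subspace s1 H" "inj_on \<phi> H"
    and "module.subspace s1 U" "U \<subseteq> H"
  shows "vector_space.dim s2 (\<phi> ` U) = vector_space.dim s1 U"
proof -
  interpret L: Vector_Spaces.linear s1 s2 \<phi> by fact
  obtain B where B: "B \<subseteq> U" "L.vs1.independent B" "U \<subseteq> L.vs1.span B" "card B = L.vs1.dim U"
    using L.vs1.basis_exists by blast
  have sp: "L.vs1.span B = U"
    using B(3) L.vs1.span_minimal[OF B(1) assms(4)] by simp
  have inj: "inj_on \<phi> (L.vs1.span B)"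
    unfolding sp by (rule inj_on_subset[OF assms(3,5)])
  have "L.vs2.independent (\<phi> ` B)"
    by (rule L.independent_injective_image[OF B(2) inj])
  moreover have "L.vs2.span (\<phi> ` B) = L.vs2.span (\<phi> ` U)"
  proof -
    have 1: "L.vs2.span (\<phi> ` B) = \<phi> ` U" using L.span_image[of B] unfolding sp .
    have 2: "L.vs2.span (\<phi> ` U) = \<phi> ` U"
      by (rule L.vs2.span_eq_iff[THEN iffD2, OF L.subspace_image[OF assms(4)]])
    show ?thesis by (rule trans[OF 1 2[symmetric]])
  qed
  ultimately have "L.vs2.dim (\<phi> ` U) = card (\<phi> ` B)"
    by (intro L.vs2.dim_eq_card)
  also have "\<dots> = card B"
    by (rule card_image[OF inj_on_subset[OF inj L.vs1.span_superset]])
  finally show ?thesis using B by simp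
qed

lemma matricube_representableI:
  fixes scale :: "'k::field \<Rightarrow> 'v::ab_group_add \<Rightarrow> 'v"
  assumes "vector_space scale" and "m \<ge> 1"
    and "flag_representation scale m \<rho> r H F"
  shows "matricube_representable TYPE('k) m \<rho> r"
proof -
  interpret V: vector_space scale by fact
  have H: "findim_subspace scale H"
    and flag: "\<And>i. i \<in> {1..m} \<Longrightarrow> initial_flag scale H (\<rho> i) (F i)"
    and rk: "\<And>x. x \<in> hypercuboid m \<rho> \<Longrightarrow> r x = codim scale H (\<Inter>i\<in>{1..m}. F i (x i))"
    using assms(3) unfolding flag_representation_def by auto
  obtain \<phi> where lin: "Vector_Spaces.linear scale seq_scale \<phi>" and inj: "inj_on \<phi> H"
    using linear_embedding_exists[OF assms(1) H] by blast
  interpret L: Vector_Spaces.linear scale seq_scale \<phi> by fact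
  have subH: "V.subspace H" using H unfolding findim_subspace_def by auto
  have sub: "V.subspace (F i t)" if "i \<in> {1..m}" "t \<le> \<rho> i" for i t
    using flag[OF that(1)] that(2) unfolding initial_flag_def by blast
  have FH: "F i t \<subseteq> H" if i: "i \<in> {1..m}" and "t \<le> \<rho> i" for i t
    using that(2)
  proof (induction t)
    case 0
    then show ?case using flag[OF i] unfolding initial_flag_def by simp
  next
    case (Suc t)
    then have "F i (Suc t) \<subseteq> F i t"
      using flag[OF i] unfolding initial_flag_def by (auto dest!: bspec[of _ _ "Suc t"])
    with Suc show ?case by auto
  qed
  have codim: "codim seq_scale (\<phi> ` U) (\<phi> ` W) = codim scale U W"
    if "V.subspace U" "U \<subseteq> H" "V.subspace W" "W \<subseteq> H" for U W
    using that dim_image_inj[OF lin H inj]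
    by (simp add: codim_def)
  have "flag_representation seq_scale m \<rho> r (\<phi> ` H) (\<lambda>i t. \<phi> ` F i t)"
    unfolding flag_representation_def
  proof (intro conjI ballI)
    obtain B where B: "finite B" "V.span B = H"
      using H unfolding findim_subspace_def by auto
    then have "finite (\<phi> ` B)" "seq.span (\<phi> ` B) = \<phi> ` H"
      using L.span_image by auto
    then show "findim_subspace seq_scale (\<phi> ` H)"
      unfolding findim_subspace_def by blast
  next
    fix i assume i: "i \<in> {1..m}"
    have f: "F i 0 = H" "{0} \<subset> F i (\<rho> i)"
      "\<And>t. t \<in> {1..\<rho> i} \<Longrightarrow> F i t \<subseteq> F i (t - 1) \<and> codim scale (F i (t - 1)) (F i t) \<in> {0, 1}"
      using flag[OF i] unfolding initial_flag_def by auto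
    obtain z where z: "z \<in> F i (\<rho> i)" "z \<noteq> 0" using f(2) by blast
    have "0 \<in> F i (\<rho> i)" using f(2) by blast
    have "\<phi> z \<noteq> \<phi> 0"
      using inj_on_eq_iff[OF inj, of z 0] z \<open>0 \<in> _\<close> FH[OF i order_refl] by auto
    then have "\<phi> z \<noteq> 0" "0 \<in> \<phi> ` F i (\<rho> i)"
      using L.zero image_eqI[OF _ \<open>0 \<in> F i (\<rho> i)\<close>, of 0 \<phi>] by simp_all
    then have "{0} \<subset> \<phi> ` F i (\<rho> i)" using z by blast
    moreover have "seq.subspace (\<phi> ` F i t)" if "t \<le> \<rho> i" for t
      using sub[OF i that] by (rule L.subspace_image)
    moreover have "\<phi> ` F i t \<subseteq> \<phi> ` F i (t - 1) \<and>
        codim seq_scale (\<phi> ` F i (t - 1)) (\<phi> ` F i t) \<in> {0, 1}" if t: "t \<in> {1..\<rho> i}" for t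
    proof -
      have "t \<le> \<rho> i" "t - 1 \<le> \<rho> i" using t by auto
      then show ?thesis using f(3)[OF t] codim sub[OF i] FH[OF i] by (simp add: image_mono)
    qed
    ultimately show "initial_flag seq_scale (\<phi> ` H) (\<rho> i) (\<lambda>t. \<phi> ` F i t)"
      unfolding initial_flag_def using f(1) by simp
  next
    fix x assume x: "x \<in> hypercuboid m \<rho>"
    have xi: "x i \<le> \<rho> i" if "i \<in> {1..m}" for i
      using x that by (simp add: hypercuboid_def)
    have one: "1 \<in> {1..m}" using \<open>m \<ge> 1\<close> by simp
    have "\<forall>i\<in>{1..m}. F i (x i) \<subseteq> H"
      using FH xi by blast
    from image_INT[OF inj this one]
    have "(\<Inter>i\<in>{1..m}. \<phi> ` F i (x i)) = \<phi> ` (\<Inter>i\<in>{1..m}. F i (x i))" by simp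
    moreover have "V.subspace (\<Inter>i\<in>{1..m}. F i (x i))"
      using sub xi by (intro V.subspace_Inter) auto
    moreover have "(\<Inter>i\<in>{1..m}. F i (x i)) \<subseteq> H"
      using FH[OF one xi[OF one]] one by blast
    ultimately show "r x = codim seq_scale (\<phi> ` H) (\<Inter>i\<in>{1..m}. \<phi> ` F i (x i))"
      using rk[OF x] codim[OF subH order_refl] by simp
  qed
  then show ?thesis
    unfolding matricube_representable_def by blast
qed

lemma matroid_representableI:
  fixes scale :: "'k::field \<Rightarrow> 'v::ab_group_add \<Rightarrow> 'v"
  assumes "vector_space scale" and "finite E"
    and "vector_representation scale E rk v"
  shows "matroid_representable TYPE('k) E rk"
proof -
  interpret V: vector_space scale by fact
  have H: "findim_subspace scale (V.span (v ` E))"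
    unfolding findim_subspace_def using \<open>finite E\<close> by blast
  obtain \<phi> where lin: "Vector_Spaces.linear scale seq_scale \<phi>" and inj: "inj_on \<phi> (V.span (v ` E))"
    using linear_embedding_exists[OF assms(1) H] by blast
  interpret L: Vector_Spaces.linear scale seq_scale \<phi> by fact
  have "independent_family seq_scale (\<phi> \<circ> v) Y \<longleftrightarrow> independent_family scale v Y" if "Y \<subseteq> E" for Y
  proof -
    have inj': "inj_on \<phi> (V.span (v ` Y))"
      by (rule inj_on_subset[OF inj V.span_mono[OF image_mono[OF that]]])
    have "inj_on \<phi> (v ` Y)"
      by (rule inj_on_subset[OF inj' V.span_superset])
    then have "inj_on (\<phi> \<circ> v) Y \<longleftrightarrow> inj_on v Y"
      using comp_inj_on[of v Y \<phi>] inj_on_imageI2[of \<phi> v Y] by blast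
    moreover have "seq.independent (\<phi> ` (v ` Y)) \<longleftrightarrow> V.independent (v ` Y)"
    proof
      assume indep: "seq.independent (\<phi> ` (v ` Y))"
      show "V.independent (v ` Y)"
      proof
        assume "V.dependent (v ` Y)"
        then obtain a where a: "a \<in> v ` Y" "a \<in> V.span (v ` Y - {a})"
          unfolding V.dependent_def by blast
        then have "\<phi> a \<in> seq.span (\<phi> ` (v ` Y - {a}))"
          using L.span_image by blast
        moreover have "\<phi> ` (v ` Y - {a}) = \<phi> ` (v ` Y) - {\<phi> a}"
          using \<open>inj_on \<phi> (v ` Y)\<close> a(1) by (auto dest: inj_onD)
        ultimately show False
          using indep a(1) unfolding seq.dependent_def by auto
      qed
    next
      assume "V.independent (v ` Y)"
      then show "seq.independent (\<phi> ` (v ` Y))"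
        by (rule L.independent_injective_image[OF _ inj'])
    qed
    ultimately show ?thesis
      by (simp add: independent_family_def image_comp)
  qed
  then have "vector_representation seq_scale E rk (\<phi> \<circ> v)"
    using assms(3) by (simp add: vector_representation_def)
  then show ?thesis
    unfolding matroid_representable_def by blast
qed


text \<open>\<open>natural_rank\<close> is the rank function of a matroid on \<open>natural_ground\<close>.\<close>

lemma finite_polymatroid_ground: "finite (polymatroid_ground m \<rho>)"
  by (simp add: polymatroid_ground_def)

lemma join_le_iff:
  assumes "finite S"
  shows "join S \<le> z \<longleftrightarrow> (\<forall>(i, t)\<in>S. t \<le> z i)"
proof -
  have "axis_point i t \<le> z \<longleftrightarrow> t \<le> z i" for i t
    by (auto simp: axis_point_def le_fun_def)
  then show ?thesis
    using assms unfolding join_def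
    by (subst Sup_fin.bounded_iff) (auto simp: le_fun_def split: prod.splits)
qed

lemma join_in_hypercuboid:
  assumes "S \<subseteq> polymatroid_ground m \<rho>"
  shows "join S \<in> hypercuboid m \<rho>"
proof -
  have "finite S" using assms finite_polymatroid_ground finite_subset by blast
  then have "join S \<le> (\<lambda>j. if j \<in> {1..m} then \<rho> j else 0)"
    using assms by (subst join_le_iff) (auto simp: polymatroid_ground_def)
  then show ?thesis
    by (auto simp: hypercuboid_def le_fun_def split: if_splits)
qed

lemma join_mono:
  assumes "S \<subseteq> T" "finite T"
  shows "join S \<le> join T"
  using assms join_le_iff[of T "join T"] join_le_iff[of S "join T"] finite_subset by blast

lemma join_Un:
  assumes "finite S" "finite T"
  shows "join (S \<union> T) = sup (join S) (join T)"
proof (rule antisym)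
  show "join (S \<union> T) \<le> sup (join S) (join T)"
  proof (subst join_le_iff)
    have "\<forall>(i, t)\<in>S. t \<le> join S i" "\<forall>(i, t)\<in>T. t \<le> join T i"
      using assms join_le_iff by blast+
    then show "\<forall>(i, t)\<in>S \<union> T. t \<le> sup (join S) (join T) i"
      by (auto simp: sup_fun_def le_supI1 le_supI2 split: prod.splits)
  qed (use assms in simp)
  show "sup (join S) (join T) \<le> join (S \<union> T)"
    using assms by (simp add: join_mono)
qed

context matricube
begin

lemma polymatroid_rank_mono:
  assumes "S \<subseteq> T" "T \<subseteq> polymatroid_ground m \<rho>"
  shows "polymatroid_rank r S \<le> polymatroid_rank r T"
proof -
  have "finite T"
    using assms finite_polymatroid_ground finite_subset by blast
  then show ?thesis
    unfolding polymatroid_rank_def using assms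
    by (intro rank_mono join_in_hypercuboid join_mono) auto
qed

lemma polymatroid_rank_submodular:
  assumes "S \<subseteq> polymatroid_ground m \<rho>" "T \<subseteq> polymatroid_ground m \<rho>"
  shows "polymatroid_rank r (S \<union> T) + polymatroid_rank r (S \<inter> T)
           \<le> polymatroid_rank r S + polymatroid_rank r T"
proof -
  have fin: "finite S" "finite T"
    using assms finite_polymatroid_ground finite_subset by blast+
  have hyp: "join S \<in> hypercuboid m \<rho>" "join T \<in> hypercuboid m \<rho>"
    "join (S \<inter> T) \<in> hypercuboid m \<rho>"
    using assms by (auto intro!: join_in_hypercuboid)
  then have "inf (join S) (join T) \<in> hypercuboid m \<rho>"
    by (auto simp: hypercuboid_def inf_fun_def min_def inf_nat_def)
  moreover have "join (S \<inter> T) \<le> inf (join S) (join T)"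
    using fin by (simp add: join_mono)
  ultimately show ?thesis
    using rank_submodular[OF hyp(1,2)] rank_mono hyp(3) join_Un[OF fin]
    unfolding polymatroid_rank_def by fastforce
qed

lemma polymatroid_rank_nonneg:
  assumes "S \<subseteq> polymatroid_ground m \<rho>"
  shows "0 \<le> polymatroid_rank r S"
  using polymatroid_rank_mono[of "{}" S] assms rank_zero
  by (simp add: polymatroid_rank_def join_def)

lemma natural_rank_le:
  assumes "S \<subseteq> polymatroid_ground m \<rho>"
  shows "natural_rank m \<rho> r Y \<le> polymatroid_rank r S + int (card (Y - blow_up r S))"
  unfolding natural_rank_def using assms
  by (intro Min_le) (auto simp: polymatroid_ground_def)

lemma natural_rank_attained:
  obtains S where "S \<subseteq> polymatroid_ground m \<rho>"
    "natural_rank m \<rho> r Y = polymatroid_rank r S + int (card (Y - blow_up r S))"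
proof -
  have "natural_rank m \<rho> r Y \<in>
      (\<lambda>S. polymatroid_rank r S + int (card (Y - blow_up r S))) ` Pow (polymatroid_ground m \<rho>)"
    unfolding natural_rank_def by (intro Min_in) (auto simp: polymatroid_ground_def)
  with that show ?thesis by blast
qed

lemma natural_matroid:
  shows "finite (natural_ground m \<rho> r)"
    and "\<And>Y. 0 \<le> natural_rank m \<rho> r Y"
    and "\<And>Y. natural_rank m \<rho> r Y \<le> int (card Y)"
    and "\<And>Y Z. \<lbrakk>Y \<subseteq> Z; Z \<subseteq> natural_ground m \<rho> r\<rbrakk> \<Longrightarrow> natural_rank m \<rho> r Y \<le> natural_rank m \<rho> r Z"
    and "\<And>Y Z. \<lbrakk>Y \<subseteq> natural_ground m \<rho> r; Z \<subseteq> natural_ground m \<rho> r\<rbrakk> \<Longrightarrow>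
           natural_rank m \<rho> r (Y \<union> Z) + natural_rank m \<rho> r (Y \<inter> Z)
             \<le> natural_rank m \<rho> r Y + natural_rank m \<rho> r Z"
proof -
  show fin: "finite (natural_ground m \<rho> r)"
    by (simp add: natural_ground_def blow_up_def polymatroid_ground_def)
  show "0 \<le> natural_rank m \<rho> r Y" for Y
    using natural_rank_attained[of Y] polymatroid_rank_nonneg
    by (metis add_nonneg_nonneg of_nat_0_le_iff)
  show "natural_rank m \<rho> r Y \<le> int (card Y)" for Y
    using natural_rank_le[of "{}" Y] rank_zero
    by (simp add: polymatroid_rank_def join_def blow_up_def)
  show "natural_rank m \<rho> r Y \<le> natural_rank m \<rho> r Z"
    if "Y \<subseteq> Z" "Z \<subseteq> natural_ground m \<rho> r" for Y Z
  proof -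
    obtain S where S: "S \<subseteq> polymatroid_ground m \<rho>"
      "natural_rank m \<rho> r Z = polymatroid_rank r S + int (card (Z - blow_up r S))"
      using natural_rank_attained by blast
    have "finite Z" using that fin finite_subset by blast
    then have "card (Y - blow_up r S) \<le> card (Z - blow_up r S)"
      using that by (intro card_mono) auto
    with S natural_rank_le[OF S(1), of Y] show ?thesis by linarith
  qed
  show "natural_rank m \<rho> r (Y \<union> Z) + natural_rank m \<rho> r (Y \<inter> Z)
      \<le> natural_rank m \<rho> r Y + natural_rank m \<rho> r Z"
    if "Y \<subseteq> natural_ground m \<rho> r" "Z \<subseteq> natural_ground m \<rho> r" for Y Z
  proof -
    obtain S T where S: "S \<subseteq> polymatroid_ground m \<rho>"
        "natural_rank m \<rho> r Y = polymatroid_rank r S + int (card (Y - blow_up r S))"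
      and T: "T \<subseteq> polymatroid_ground m \<rho>"
        "natural_rank m \<rho> r Z = polymatroid_rank r T + int (card (Z - blow_up r T))"
      using natural_rank_attained by metis
    define A where "A = Y - blow_up r S"
    define B where "B = Z - blow_up r T"
    have "finite Y" "finite Z" using that fin finite_subset by blast+
    then have AB: "finite A" "finite B" by (auto simp: A_def B_def)
    define C where "C = (Y \<union> Z) - blow_up r (S \<union> T)"
    define D where "D = (Y \<inter> Z) - blow_up r (S \<inter> T)"
    have sub: "C \<union> D \<subseteq> A \<union> B" "C \<inter> D \<subseteq> A \<inter> B"
      by (auto simp: A_def B_def C_def D_def blow_up_def)
    have CD: "finite C" "finite D"
      using \<open>finite Y\<close> \<open>finite Z\<close> by (auto simp: C_def D_def)
    have "card C + card D = card (C \<union> D) + card (C \<inter> D)"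
      using card_Un_Int CD by blast
    also have "\<dots> \<le> card (A \<union> B) + card (A \<inter> B)"
      using sub AB by (intro add_mono card_mono) auto
    also have "\<dots> = card A + card B"
      using card_Un_Int[OF AB] by simp
    finally have "card C + card D \<le> card A + card B" .
    moreover have "natural_rank m \<rho> r (Y \<union> Z) \<le> polymatroid_rank r (S \<union> T) + int (card C)"
      unfolding C_def using S T by (intro natural_rank_le) auto
    moreover have "natural_rank m \<rho> r (Y \<inter> Z) \<le> polymatroid_rank r (S \<inter> T) + int (card D)"
      unfolding D_def using S T by (intro natural_rank_le) auto
    ultimately show ?thesis
      using polymatroid_rank_submodular[OF S(1) T(1)] S(2) T(2) unfolding A_def B_def by linarith
  qed
qed

end

end

theory Submission
  imports Defs
begin

text \<open>
  Both kinds of representation are compared with a third one: a family of finite-dimensional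
  subspaces \<open>L e\<close>, one for each element \<open>e\<close> of the natural polymatroid, such that the rank of a
  set \<open>S\<close> of elements is the dimension of the sum of the \<open>L e\<close> with \<open>e \<in> S\<close>.

  Flags and such families are dual to each other.  The annihilators, in the dual of the ambient
  space, of the members of the flags form a family of this kind, because annihilators turn
  intersections into sums and codimensions into dimensions (\<open>dim_UN_annihilator\<close>).  Conversely,
  the rank function of the natural polymatroid forces the subspaces at the points \<open>t e\<^sub>i\<close> of one
  axis to increase with \<open>t\<close>, by at most one dimension at each step, so that their annihilators
  form a flag.  The flag does not end in \<open>0\<close> if the ambient space has been chosen strictly larger
  than the sum of all the subspaces.

  From subspaces to the natural matroid one passes by choosing, for every \<open>e\<close>, as many vectors
  in \<open>L e\<close> as \<open>e\<close> has copies, as generically as possible.  Over an infinite field they can be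
  chosen such that the only linear relations among them are those forced by the dimensions of
  sums of the \<open>L e\<close> (\<open>generic_vectors_exist\<close>); this is what the minimum in the rank function of
  the natural matroid expresses.  Conversely, if vectors represent the natural matroid, the
  copies of \<open>e\<close> span a suitable subspace \<open>L e\<close>, because the natural matroid gives the set of all
  copies of the elements of \<open>S\<close> the rank that \<open>S\<close> has in the polymatroid
  (\<open>natural_rank_blow_up\<close>).
\<close>

section \<open>Finite-dimensional subspaces\<close>

context vector_space
begin

lemma findim_subspace_imp_subspace: "findim_subspace scale H \<Longrightarrow> subspace H"
  unfolding findim_subspace_def by auto

lemma findim_subspace_span: "finite B \<Longrightarrow> findim_subspace scale (span B)"
  unfolding findim_subspace_def by blast

lemma basis_extension:
  assumes "findim_subspace scale H" "subspace U" "U \<subseteq> H"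
  obtains A B where "A \<subseteq> B" "finite B" "independent B" "span A = U" "span B = H"
    "card A = dim U" "card B = dim H"
proof -
  obtain C where C: "finite C" "span C = H"
    using assms(1) unfolding findim_subspace_def by auto
  obtain A where A: "A \<subseteq> U" "independent A" "U \<subseteq> span A"
    by (rule maximal_independent_subset)
  obtain B where B: "A \<subseteq> B" "B \<subseteq> H" "independent B" "H \<subseteq> span B"
    using maximal_independent_subset_extend[of A H] A assms(3) by blast
  have "span A = U"
    using A assms(2) by (rule_tac span_subspace)
  moreover have "span B = H"
    using B findim_subspace_imp_subspace[OF assms(1)] by (rule_tac span_subspace)
  moreover have "finite B"
    using independent_span_bound[OF C(1) B(3)] B(2) C(2) by blast
  ultimately show ?thesis
    using that[of A B] A B basis_card_eq_dim by auto
qed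

lemma findim_basis:
  assumes "findim_subspace scale H"
  obtains B where "finite B" "independent B" "span B = H" "card B = dim H"
  by (rule basis_extension[OF assms findim_subspace_imp_subspace[OF assms] order_refl]) (rule that)

lemma findim_subspace_subset:
  assumes "findim_subspace scale H" "subspace U" "U \<subseteq> H"
  shows "findim_subspace scale U"
proof -
  obtain A B where "A \<subseteq> B" "finite B" "span A = U"
    using basis_extension[OF assms] .
  then show ?thesis
    using findim_subspace_span[of A] finite_subset by auto
qed

lemma findim_subspace_span_subset:
  assumes "findim_subspace scale H" "U \<subseteq> H"
  shows "findim_subspace scale (span U)"
  using findim_subspace_subset[OF assms(1)] span_minimal[OF assms(2)]
    findim_subspace_imp_subspace[OF assms(1)] by auto

lemma findim_dim_mono:
  assumes "findim_subspace scale H" "U \<subseteq> H"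
  shows "dim U \<le> dim H"
proof -
  obtain B where "finite B" "span B = H" "card B = dim H"
    using findim_basis[OF assms(1)] .
  then show ?thesis
    using dim_le_card[of U B] assms(2) by simp
qed

lemma findim_dim_eqD:
  assumes "findim_subspace scale H" "subspace U" "U \<subseteq> H" "dim H \<le> dim U"
  shows "U = H"
proof -
  obtain A B where AB: "A \<subseteq> B" "finite B" "span A = U" "span B = H"
    "card A = dim U" "card B = dim H"
    using basis_extension[OF assms(1-3)] .
  then have "A = B"
    using assms(4) by (intro card_seteq) auto
  with AB show ?thesis by simp
qed

lemma findim_subspace_span_UN:
  assumes "finite S" "\<And>e. e \<in> S \<Longrightarrow> findim_subspace scale (L e)"
  shows "findim_subspace scale (span (\<Union>e\<in>S. L e))"
proof -
  have "\<forall>e\<in>S. \<exists>B. finite B \<and> span B = L e"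
    using assms(2) unfolding findim_subspace_def by blast
  then obtain B where B: "\<And>e. e \<in> S \<Longrightarrow> finite (B e) \<and> span (B e) = L e"
    by metis
  have "span (\<Union>e\<in>S. B e) = span (\<Union>e\<in>S. L e)"
  proof (rule antisym)
    show "span (\<Union>e\<in>S. B e) \<subseteq> span (\<Union>e\<in>S. L e)"
      using B span_superset by (intro span_mono) blast
    have "L e \<subseteq> span (\<Union>e\<in>S. B e)" if "e \<in> S" for e
      using B[OF that] span_mono[of "B e" "\<Union>e\<in>S. B e"] that by blast
    then show "span (\<Union>e\<in>S. L e) \<subseteq> span (\<Union>e\<in>S. B e)"
      by (intro span_minimal) auto
  qed
  then show ?thesis
    using findim_subspace_span[of "\<Union>e\<in>S. B e"] B assms(1) by auto
qed

lemma dim_insert_new: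
  assumes "findim_subspace scale (span X)" "x \<notin> span X"
  shows "dim (insert x X) = dim X + 1"
proof -
  obtain B where B: "finite B" "independent B" "span B = span X" "card B = dim (span X)"
    using findim_basis[OF assms(1)] .
  have "independent (insert x B)" "x \<notin> B"
    using B assms(2) independent_insertI span_base by auto
  moreover have "span (insert x B) = span (insert x X)"
    using B(3) by (simp add: span_insert)
  ultimately have "dim (insert x X) = card (insert x B)"
    by (intro dim_eq_card)
  then show ?thesis
    using B \<open>x \<notin> B\<close> by simp
qed

lemma dim_insert_le:
  assumes "findim_subspace scale (span X)"
  shows "dim (insert x X) \<le> dim X + 1"
proof (cases "x \<in> span X")
  case True
  then have "dim (insert x X) = dim X"
    by (intro span_eq_dim span_redundant)
  then show ?thesis by simp
qed (simp add: dim_insert_new[OF assms])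

lemma independent_family_iff_dim:
  assumes "finite Y"
  shows "independent_family scale v Y \<longleftrightarrow> dim (v ` Y) = card Y"
proof
  assume "independent_family scale v Y"
  then show "dim (v ` Y) = card Y"
    unfolding independent_family_def by (simp add: dim_eq_card_independent card_image)
next
  assume eq: "dim (v ` Y) = card Y"
  obtain B where B: "B \<subseteq> v ` Y" "independent B" "v ` Y \<subseteq> span B" "card B = dim (v ` Y)"
    using basis_exists .
  have "card Y \<le> card (v ` Y)"
    using B eq assms by (metis card_mono finite_imageI)
  then have card: "card (v ` Y) = card Y"
    using card_image_le[OF assms, of v] by simp
  then have "B = v ` Y"
    using B eq assms by (intro card_seteq) auto
  then show "independent_family scale v Y"
    unfolding independent_family_def using B assms card eq_card_imp_inj_on by blast
qed

end


section \<open>Annihilators\<close>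

definition functional_scale :: "'k::field \<Rightarrow> ('v \<Rightarrow> 'k) \<Rightarrow> ('v \<Rightarrow> 'k)" where
  "functional_scale c g = (\<lambda>x. c * g x)"

global_interpretation functional: vector_space "functional_scale :: 'k::field \<Rightarrow> ('v \<Rightarrow> 'k) \<Rightarrow> _"
  by unfold_locales (auto simp: functional_scale_def fun_eq_iff algebra_simps)

lemma seq_scale_eq: "seq_scale = functional_scale"
  by (simp add: fun_eq_iff seq_scale_def functional_scale_def)

text \<open>
  The linear functionals on a subspace, as total functions.  The value 0 off \<open>H\<close> makes a
  functional determined by its restriction, so that the dual has the dimension of \<open>H\<close>.
\<close>

definition dual :: "('k::field \<Rightarrow> 'v::ab_group_add \<Rightarrow> 'v) \<Rightarrow> 'v set \<Rightarrow> ('v \<Rightarrow> 'k) set" where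
  "dual scale H = {g. (\<forall>x. x \<notin> H \<longrightarrow> g x = 0) \<and> (\<forall>x\<in>H. \<forall>y\<in>H. g (x + y) = g x + g y) \<and>
     (\<forall>c. \<forall>x\<in>H. g (scale c x) = c * g x)}"

definition annihilator ::
  "('k::field \<Rightarrow> 'v::ab_group_add \<Rightarrow> 'v) \<Rightarrow> 'v set \<Rightarrow> 'v set \<Rightarrow> ('v \<Rightarrow> 'k) set" where
  "annihilator scale H U = {g \<in> dual scale H. \<forall>u\<in>U. g u = 0}"

lemma sum_functional_apply:
  "(\<Sum>b\<in>B. functional_scale (u b) (c b)) x = (\<Sum>b\<in>B. u b * c b x)"
  by (induction B rule: infinite_finite_induct) (auto simp: functional_scale_def)

text \<open>
  Evaluating a linear relation at the points \<open>p b\<close> isolates its coefficients.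
\<close>

lemma biorthogonal_independent:
  fixes c :: "'b \<Rightarrow> 'v \<Rightarrow> 'k::field"
  assumes "finite B" and c: "\<And>a b. \<lbrakk>a \<in> B; b \<in> B\<rbrakk> \<Longrightarrow> c a (p b) = (if a = b then 1 else 0)"
  shows "inj_on c B" and "functional.independent (c ` B)"
proof -
  show inj: "inj_on c B"
    by (rule inj_onI) (metis c zero_neq_one)
  show "functional.independent (c ` B)"
  proof (rule functional.independent_if_scalars_zero)
    fix u g assume "(\<Sum>g\<in>c ` B. functional_scale (u g) g) = 0" "g \<in> c ` B"
    then obtain b where b: "b \<in> B" "g = c b" by blast
    have "(\<Sum>a\<in>B. functional_scale (u (c a)) (c a)) = 0"
      using \<open>_ = 0\<close> by (simp add: sum.reindex[OF inj])
    from fun_cong[OF this, of "p b"] have "0 = (\<Sum>a\<in>B. u (c a) * c a (p b))"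
      by (simp add: sum_functional_apply)
    also have "\<dots> = (\<Sum>a\<in>B. if a = b then u (c a) else 0)"
      using b c by (intro sum.cong) auto
    finally show "u g = 0"
      using b assms(1) by simp
  qed (use assms(1) in simp)
qed

context vector_space
begin

lemma subspace_annihilator: "functional.subspace (annihilator scale H U)"
  by (rule functional.subspaceI)
     (auto simp: annihilator_def dual_def functional_scale_def algebra_simps)

lemma annihilator_antimono: "U \<subseteq> W \<Longrightarrow> annihilator scale H W \<subseteq> annihilator scale H U"
  by (auto simp: annihilator_def)

lemma annihilator_zero: "subspace H \<Longrightarrow> annihilator scale H {0} = dual scale H"
proof -
  assume "subspace H"
  have "g 0 = 0" if "g \<in> dual scale H" for g
    using that subspace_0[OF \<open>subspace H\<close>] by (auto simp: dual_def dest!: bspec[of H _ 0] spec[of _ 0])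
  then show ?thesis by (auto simp: annihilator_def)
qed

lemma subspace_common_zeros:
  assumes "subspace H" "C \<subseteq> dual scale H"
  shows "subspace {x \<in> H. \<forall>g\<in>C. g x = 0}"
proof -
  have "subspace {x \<in> H. g x = 0}" if "g \<in> C" for g
  proof -
    have g: "g \<in> dual scale H" using that assms(2) by blast
    then have "g 0 = 0"
      using annihilator_zero[OF assms(1)] by (auto simp: annihilator_def)
    with g show ?thesis
      using assms(1) by (auto simp: subspace_def dual_def)
  qed
  then have "subspace (H \<inter> (\<Inter>g\<in>C. {x \<in> H. g x = 0}))"
    using assms(1) by (intro subspace_inter subspace_Int) auto
  also have "H \<inter> (\<Inter>g\<in>C. {x \<in> H. g x = 0}) = {x \<in> H. \<forall>g\<in>C. g x = 0}"
    by auto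
  finally show ?thesis .
qed

lemma annihilator_span:
  assumes "subspace H" "U \<subseteq> H"
  shows "annihilator scale H (span U) = annihilator scale H U"
proof (rule antisym)
  show "annihilator scale H U \<subseteq> annihilator scale H (span U)"
  proof
    fix g assume g: "g \<in> annihilator scale H U"
    then have "span U \<subseteq> {x \<in> H. \<forall>g\<in>{g}. g x = 0}"
      using assms by (intro span_minimal subspace_common_zeros) (auto simp: annihilator_def)
    with g show "g \<in> annihilator scale H (span U)"
      by (auto simp: annihilator_def)
  qed
qed (rule annihilator_antimono[OF span_superset])

text \<open>
  Each equation lowers the dimension of the space of solutions by at most one, since the
  solutions of the previous equations are spanned by those of the new one and a single vector.
\<close>

lemma dim_common_zeros:
  assumes H: "findim_subspace scale H" and "finite C" "C \<subseteq> dual scale H"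
  shows "dim H \<le> dim {x \<in> H. \<forall>g\<in>C. g x = 0} + card C"
  using assms(2,3)
proof (induction C rule: finite_induct)
  case (insert g C)
  define X where "X = {x \<in> H. \<forall>g\<in>C. g x = 0}"
  define Z where "Z = {x \<in> H. \<forall>g\<in>insert g C. g x = 0}"
  have subH: "subspace H" using H by (rule findim_subspace_imp_subspace)
  have sub: "subspace X" "subspace Z"
    unfolding X_def Z_def using insert.prems by (intro subspace_common_zeros subH; simp)+
  have finZ: "findim_subspace scale (span Z)"
    by (rule findim_subspace_span_subset[OF H]) (auto simp: Z_def)
  have g: "g (x + y) = g x + g y" "g (scale c x) = c * g x" if "x \<in> H" "y \<in> H" for x y c
    using insert.prems that by (auto simp: dual_def)
  have "dim X \<le> dim Z + 1"
  proof (cases "\<exists>w\<in>X. g w \<noteq> 0")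
    case False
    then have "X = Z" by (auto simp: X_def Z_def)
    then show ?thesis by simp
  next
    case True
    then obtain w where w: "w \<in> X" "g w \<noteq> 0" by blast
    have "X \<subseteq> span (insert w Z)"
    proof
      fix x assume x: "x \<in> X"
      define z where "z = x + scale (- (g x / g w)) w"
      have "w \<in> H" "x \<in> H" using w x by (auto simp: X_def)
      then have "g z = 0"
        unfolding z_def using w(2) subspace_scale[OF subH] by (subst g) (auto simp: g simp del: scale_minus_left)
      moreover have "z \<in> X"
        unfolding z_def using x w(1) sub(1) by (intro subspace_add subspace_scale)
      ultimately have "z \<in> Z" by (auto simp: X_def Z_def)
      then have "x - scale (g x / g w) w \<in> span Z"
        using span_base by (simp add: z_def)
      then show "x \<in> span (insert w Z)"
        by (auto simp: span_breakdown_eq)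
    qed
    moreover have "findim_subspace scale (span (insert w Z))"
    proof (rule findim_subspace_subset[OF H])
      show "span (insert w Z) \<subseteq> H"
        using w(1) subH by (intro span_minimal) (auto simp: X_def Z_def)
    qed simp
    ultimately have "dim X \<le> dim (span (insert w Z))"
      by (intro findim_dim_mono)
    with dim_insert_le[OF finZ, of w] show ?thesis by simp
  qed
  then show ?case
    using insert unfolding X_def Z_def by simp
qed simp

lemma coordinate_in_dual:
  assumes "independent B" "span B = H"
  shows "(\<lambda>x. representation B x b) \<in> dual scale H"
proof -
  have "representation B x b = 0" if "x \<notin> H" for x
    using that assms by (simp add: representation_def)
  then show ?thesis
    using assms by (auto simp: dual_def representation_add representation_scale)
qed

text \<open>
  The coordinate functionals of the basis vectors outside \<open>A\<close> vanish on \<open>U\<close>, and a functional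
  \<open>g\<close> that vanishes on \<open>U\<close> is their combination with the coefficients \<open>g b\<close>.
\<close>

lemma annihilator_basis:
  assumes "A \<subseteq> B" "finite B" "independent B" "span A = U" "span B = H"
  shows "functional.span ((\<lambda>b x. representation B x b) ` (B - A)) = annihilator scale H U"
    and "functional.dim (annihilator scale H U) = card (B - A)"
proof -
  let ?c = "\<lambda>b x. representation B x b"
  have mem: "?c b \<in> annihilator scale H U" if "b \<in> B - A" for b
  proof -
    have "representation B x b = 0" if "x \<in> U" for x
      using representation_extend[OF assms(3), of x A] representation_ne_zero[of A x b]
        assms that \<open>b \<in> B - A\<close> by auto
    then show ?thesis
      using coordinate_in_dual[OF assms(3,5)] by (auto simp: annihilator_def)
  qed
  have "g \<in> functional.span (?c ` (B - A))" if g: "g \<in> annihilator scale H U" for g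
  proof -
    have "g = (\<Sum>b\<in>B - A. functional_scale (g b) (?c b))"
    proof
      fix x
      show "g x = (\<Sum>b\<in>B - A. functional_scale (g b) (?c b)) x"
      proof (cases "x \<in> H")
        case False
        then have "g x = 0" using g by (simp add: annihilator_def dual_def)
        moreover have "representation B x b = 0" for b
          using False assms by (simp add: representation_def)
        ultimately show ?thesis by (simp add: sum_functional_apply)
      next
        case True
        have subH: "subspace H" using assms(5) by auto
        have add: "g (y + z) = g y + g z" "g (scale c y) = c * g y" if "y \<in> H" "z \<in> H" for y z c
          using g that by (auto simp: annihilator_def dual_def)
        have BH: "B \<subseteq> H" using assms(5) span_superset by auto
        have "g (\<Sum>b\<in>D. scale (u b) b) = (\<Sum>b\<in>D. u b * g b)" if "finite D" "D \<subseteq> H" for D u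
          using that
        proof (induction D rule: finite_induct)
          case empty
          show ?case using add(2)[of 0 0 0] subspace_0[OF subH] by simp
        next
          case (insert b D)
          then have "scale (u b) b \<in> H" "(\<Sum>b\<in>D. scale (u b) b) \<in> H"
            by (auto intro!: subspace_sum subspace_scale subH)
          with insert show ?case by (simp add: add)
        qed
        from this[OF assms(2) BH, of "representation B x"]
        have "g x = (\<Sum>b\<in>B. representation B x b * g b)"
          using sum_representation_eq[OF assms(3) _ assms(2) order_refl, of x] True assms(5) by simp
        also have "\<dots> = (\<Sum>b\<in>B - A. representation B x b * g b)"
        proof (rule sum.mono_neutral_right[OF assms(2)])
          show "\<forall>b\<in>B - (B - A). representation B x b * g b = 0"
            using g assms(4) span_base by (auto simp: annihilator_def)
        qed auto
        finally show ?thesis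
          by (simp add: sum_functional_apply mult.commute)
      qed
    qed
    also have "\<dots> \<in> functional.span (?c ` (B - A))"
      by (intro functional.span_sum functional.span_scale functional.span_base) auto
    finally show ?thesis .
  qed
  then show sp: "functional.span (?c ` (B - A)) = annihilator scale H U"
    using mem by (intro antisym functional.span_minimal subspace_annihilator) auto
  have "?c a b = (if a = b then 1 else 0)" if "b \<in> B" for a b
    using representation_basis[OF assms(3) that] by simp
  then have "inj_on ?c (B - A)" "functional.independent (?c ` (B - A))"
    using assms(2) biorthogonal_independent[of "B - A" ?c id] by auto
  then show "functional.dim (annihilator scale H U) = card (B - A)"
    using functional.dim_span_eq_card_independent[of "?c ` (B - A)"] sp by (simp add: card_image)
qed

lemma dim_annihilator:
  assumes "findim_subspace scale H" "subspace U" "U \<subseteq> H"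
  shows "functional.dim (annihilator scale H U) + dim U = dim H"
proof -
  obtain A B where AB: "A \<subseteq> B" "finite B" "independent B" "span A = U" "span B = H"
    "card A = dim U" "card B = dim H"
    using basis_extension[OF assms] .
  moreover have "card (B - A) + card A = card B"
    using card_Diff_subset[OF finite_subset[OF AB(1,2)] AB(1)] card_mono[OF AB(2,1)] by simp
  ultimately show ?thesis
    using annihilator_basis(2)[OF AB(1-5)] by simp
qed

lemma findim_dual:
  assumes "findim_subspace scale H"
  shows "findim_subspace functional_scale (dual scale H)"
proof -
  have "subspace H" using assms by (rule findim_subspace_imp_subspace)
  then have zero: "{0} \<subseteq> H" by (simp add: subspace_0)
  obtain A B where AB: "A \<subseteq> B" "finite B" "independent B" "span A = {0}" "span B = H"
    using basis_extension[OF assms subspace_single_0 zero] .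
  show ?thesis
    using functional.findim_subspace_span[of "(\<lambda>b x. representation B x b) ` (B - A)"] AB(2)
      annihilator_basis(1)[OF AB] annihilator_zero[OF \<open>subspace H\<close>] by simp
qed

text \<open>
  With respect to a basis of \<open>H\<close> that extends one of \<open>U\<close>, some coordinate of \<open>h\<close> at a basis
  vector outside \<open>U\<close> is nonzero, for otherwise \<open>h\<close> would be a combination of basis vectors of \<open>U\<close>.
\<close>

lemma annihilator_separates:
  assumes "findim_subspace scale H" "subspace U" "U \<subseteq> H" "h \<in> H" "h \<notin> U"
  obtains g where "g \<in> annihilator scale H U" "g h \<noteq> 0"
proof -
  obtain A B where AB: "A \<subseteq> B" "finite B" "independent B" "span A = U" "span B = H"
    using basis_extension[OF assms(1-3)] .
  have "\<exists>b\<in>B - A. representation B h b \<noteq> 0"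
  proof (rule ccontr)
    assume "\<not> ?thesis"
    then have "(\<Sum>b\<in>B. scale (representation B h b) b) = (\<Sum>b\<in>A. scale (representation B h b) b)"
      using AB by (intro sum.mono_neutral_right) auto
    also have "\<dots> \<in> U"
      using AB(4) span_base by (intro subspace_sum subspace_scale assms(2)) auto
    finally show False
      using sum_representation_eq[OF AB(3) _ AB(2) order_refl, of h] AB(5) assms(4,5) by simp
  qed
  then obtain b where b: "b \<in> B - A" "representation B h b \<noteq> 0" by blast
  have "(\<lambda>x. representation B x b) \<in> annihilator scale H U"
    unfolding annihilator_basis(1)[OF AB, symmetric] using b(1)
    by (intro functional.span_base) (rule imageI)
  then show ?thesis using that b(2) by simp
qed

text \<open>
  Annihilators exchange intersections and sums.  The annihilators of the \<open>F e\<close> lie in that of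
  the intersection, which bounds the dimension of their sum from above.  A basis of the sum is a
  system of equations whose solutions lie in every \<open>F e\<close>, by separation; counting these
  equations gives the other bound.
\<close>

lemma dim_UN_annihilator:
  assumes H: "findim_subspace scale H" and F: "\<And>e. e \<in> S \<Longrightarrow> subspace (F e) \<and> F e \<subseteq> H"
  shows "functional.dim (\<Union>e\<in>S. annihilator scale H (F e)) + dim (H \<inter> (\<Inter>e\<in>S. F e)) = dim H"
proof -
  define I where "I = H \<inter> (\<Inter>e\<in>S. F e)"
  define P where "P = functional.span (\<Union>e\<in>S. annihilator scale H (F e))"
  have subH: "subspace H" using H by (rule findim_subspace_imp_subspace)
  have subI: "subspace I"
    unfolding I_def using subH F by (intro subspace_inter subspace_Int) auto
  have ann_findim: "findim_subspace functional_scale (annihilator scale H I)"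
    by (rule functional.findim_subspace_subset[OF findim_dual[OF H] subspace_annihilator])
       (auto simp: annihilator_def)
  have P_sub: "P \<subseteq> annihilator scale H I"
    unfolding P_def
    by (intro functional.span_minimal subspace_annihilator UN_least annihilator_antimono)
       (auto simp: I_def)
  have "findim_subspace functional_scale P"
    using functional.findim_subspace_subset[OF ann_findim _ P_sub] by (simp add: P_def)
  then obtain C where C: "finite C" "functional.span C = P" "card C = functional.dim P"
    using functional.findim_basis by blast
  have CP: "C \<subseteq> P" using C(2) functional.span_superset by blast
  then have C_dual: "C \<subseteq> dual scale H"
    using P_sub by (auto simp: annihilator_def)
  have zeros: "{x \<in> H. \<forall>g\<in>C. g x = 0} \<subseteq> I"
  proof
    fix x assume x: "x \<in> {x \<in> H. \<forall>g\<in>C. g x = 0}"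
    have "functional.span C \<subseteq> annihilator scale H {x}"
      using x C_dual by (intro functional.span_minimal subspace_annihilator) (auto simp: annihilator_def)
    then have van: "g x = 0" if "g \<in> P" for g
      using that C(2) by (auto simp: annihilator_def)
    have "x \<in> F e" if "e \<in> S" for e
    proof (rule ccontr)
      assume "x \<notin> F e"
      moreover have "subspace (F e)" "F e \<subseteq> H" "x \<in> H"
        using F[OF that] x by auto
      ultimately obtain g where "g \<in> annihilator scale H (F e)" "g x \<noteq> 0"
        using annihilator_separates[OF H] by metis
      moreover from this have "g \<in> P"
        unfolding P_def using that by (intro functional.span_base) blast
      ultimately show False using van by blast
    qed
    then show "x \<in> I" using x by (auto simp: I_def)
  qed
  have "findim_subspace scale I"
    using findim_subspace_subset[OF H subI] by (auto simp: I_def)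
  then have "dim H \<le> dim I + card C"
    using dim_common_zeros[OF H C(1) C_dual] findim_dim_mono[OF _ zeros] by simp
  moreover have "functional.dim P + dim I \<le> dim H"
    using functional.findim_dim_mono[OF ann_findim P_sub] dim_annihilator[OF H subI]
    by (simp add: I_def)
  ultimately show ?thesis
    using C(3) by (simp add: P_def I_def)
qed

end


section \<open>Generic vectors in a family of subspaces\<close>

context vector_space
begin

text \<open>
  By induction on the number of subspaces.  If \<open>w\<close> avoids all of them but \<open>U\<close>, and \<open>u\<close> is a
  vector outside \<open>U\<close>, then the points \<open>u + c w\<close> avoid \<open>U\<close>, and each other subspace contains at
  most one of them, as it would otherwise contain \<open>w\<close>.
\<close>

lemma subspace_avoids_finite_union:
  assumes "infinite (UNIV :: 'a set)" and "subspace L"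
    and "finite \<U>" "\<And>U. U \<in> \<U> \<Longrightarrow> subspace U \<and> \<not> L \<subseteq> U"
  shows "\<exists>w\<in>L. \<forall>U\<in>\<U>. w \<notin> U"
  using assms(3,4)
proof (induction \<U> rule: finite_induct)
  case empty
  then show ?case using subspace_0[OF assms(2)] by blast
next
  case (insert U \<U>)
  then obtain w where w: "w \<in> L" "\<And>W. W \<in> \<U> \<Longrightarrow> w \<notin> W" by blast
  obtain u where u: "u \<in> L" "u \<notin> U" using insert.prems by blast
  have subU: "subspace U" using insert.prems by blast
  show ?case
  proof (cases "w \<in> U")
    case False
    with w show ?thesis by blast
  next
    case True
    have at_most_one: "c = d"
      if "W \<in> \<U>" "u + scale c w \<in> W" "u + scale d w \<in> W" for W c d
    proof (rule ccontr)
      assume "c \<noteq> d"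
      have "subspace W" using insert.prems that by blast
      then have "scale (inverse (c - d)) ((u + scale c w) - (u + scale d w)) \<in> W"
        using that by (intro subspace_scale subspace_diff)
      then have "w \<in> W"
        using \<open>c \<noteq> d\<close> by (simp flip: scale_left_diff_distrib)
      with w(2) that(1) show False by blast
    qed
    have "finite {c. u + scale c w \<in> W}" if "W \<in> \<U>" for W
    proof (cases "\<exists>c. u + scale c w \<in> W")
      case True
      then obtain c where "u + scale c w \<in> W" ..
      then have "{c. u + scale c w \<in> W} \<subseteq> {c}"
        using at_most_one[OF that] by blast
      then show ?thesis using finite_subset by blast
    qed simp
    then have "finite (\<Union>W\<in>\<U>. {c. u + scale c w \<in> W})"
      using insert.hyps by blast
    then obtain c where c: "c \<notin> (\<Union>W\<in>\<U>. {c. u + scale c w \<in> W})"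
      using ex_new_if_finite[OF assms(1)] by blast
    have "u + scale c w \<notin> U"
    proof
      assume "u + scale c w \<in> U"
      then have "(u + scale c w) - scale c w \<in> U"
        using True subU by (intro subspace_diff subspace_scale)
      with u show False by simp
    qed
    moreover have "u + scale c w \<in> L"
      using u w assms(2) by (intro subspace_add subspace_scale)
    ultimately show ?thesis using c by blast
  qed
qed

text \<open>
  Here \<open>a\<close> is a copy of the element \<open>\<pi> a\<close>.  The vectors are chosen one after the other, each
  one in \<open>L (\<pi> a)\<close> but outside every span of subspaces \<open>L e\<close> and earlier vectors that does not
  contain \<open>L (\<pi> a)\<close>.  Such a vector either raises the dimension of a span by one, or the span
  contains all of \<open>L (\<pi> a)\<close>, and then \<open>\<pi> a\<close> may be put into the set \<open>T\<close> of elements whose copies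
  are not counted.
\<close>

lemma generic_vectors_exist:
  fixes L :: "'e \<Rightarrow> 'b set" and \<pi> :: "'i \<Rightarrow> 'e"
  assumes inf: "infinite (UNIV :: 'a set)" and E: "finite E"
    and L: "\<And>e. e \<in> E \<Longrightarrow> findim_subspace scale (L e)"
    and "finite A" "\<pi> ` A \<subseteq> E"
  shows "\<exists>v. (\<forall>a\<in>A. v a \<in> L (\<pi> a)) \<and>
    (\<forall>Y S. Y \<subseteq> A \<longrightarrow> S \<subseteq> E \<longrightarrow> (\<exists>T. S \<subseteq> T \<and> T \<subseteq> E \<and>
       dim (\<Union>e\<in>T. L e) + card {a \<in> Y. \<pi> a \<notin> T} \<le> dim ((\<Union>e\<in>S. L e) \<union> v ` Y)))"
  using assms(4,5)
proof (induction A rule: finite_induct)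
  case (insert a A)
  define M where "M v S Y = (\<Union>e\<in>S. L e) \<union> v ` Y" for S Y and v :: "'i \<Rightarrow> 'b"
  obtain v where v: "\<forall>a\<in>A. v a \<in> L (\<pi> a)"
    and IH: "\<And>Y S. \<lbrakk>Y \<subseteq> A; S \<subseteq> E\<rbrakk> \<Longrightarrow> \<exists>T. S \<subseteq> T \<and> T \<subseteq> E \<and>
       dim (\<Union>e\<in>T. L e) + card {a \<in> Y. \<pi> a \<notin> T} \<le> dim (M v S Y)"
    using insert by (auto simp: M_def)
  have \<pi>a: "\<pi> a \<in> E" using insert.prems by simp
  define \<U> where "\<U> = {span (M v S Y) | S Y. S \<subseteq> E \<and> Y \<subseteq> A \<and> \<not> L (\<pi> a) \<subseteq> span (M v S Y)}"
  have "\<U> \<subseteq> (\<lambda>(S, Y). span (M v S Y)) ` (Pow E \<times> Pow A)"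
    by (auto simp: \<U>_def)
  then have "finite \<U>"
    using E insert.hyps by (meson finite_Pow_iff finite_SigmaI finite_imageI finite_subset)
  moreover have "subspace U \<and> \<not> L (\<pi> a) \<subseteq> U" if "U \<in> \<U>" for U
    using that unfolding \<U>_def by blast
  ultimately obtain w where w: "w \<in> L (\<pi> a)" and avoid: "\<And>U. U \<in> \<U> \<Longrightarrow> w \<notin> U"
    using subspace_avoids_finite_union[OF inf findim_subspace_imp_subspace[OF L[OF \<pi>a]]]
    by meson
  define v' where "v' = v(a := w)"
  have M_findim: "findim_subspace scale (span (M v S Y))" if "S \<subseteq> E" "Y \<subseteq> A" for S Y
  proof -
    have H: "findim_subspace scale (span (\<Union>e\<in>E. L e))"
      using findim_subspace_span_UN E L .
    have "M v S Y \<subseteq> span (\<Union>e\<in>E. L e)"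
      using that v insert.prems unfolding M_def image_subset_iff Un_subset_iff
      by (blast intro: span_base)
    then show ?thesis
      by (rule findim_subspace_span_subset[OF H])
  qed
  have "\<exists>T. S \<subseteq> T \<and> T \<subseteq> E \<and>
      dim (\<Union>e\<in>T. L e) + card {a \<in> Y. \<pi> a \<notin> T} \<le> dim (M v' S Y)"
    if Y: "Y \<subseteq> insert a A" and S: "S \<subseteq> E" for Y S
  proof (cases "a \<in> Y")
    case False
    then have "M v' S Y = M v S Y"
      unfolding M_def v'_def by (auto simp: image_iff)
    then show ?thesis
      using IH[of Y S] False Y S by auto
  next
    case True
    define Y' where "Y' = Y - {a}"
    have Y': "Y' \<subseteq> A" "Y = insert a Y'" "a \<notin> Y'" "finite Y'"
      using Y True insert.hyps(1) finite_subset by (auto simp: Y'_def)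
    then have M_insert: "M v' S Y = insert w (M v S Y')"
      unfolding M_def v'_def by (auto simp: image_iff)
    show ?thesis
    proof (cases "w \<in> span (M v S Y')")
      case True
      then have "L (\<pi> a) \<subseteq> span (M v S Y')"
        using avoid[of "span (M v S Y')"] S Y'(1) unfolding \<U>_def by blast
      then have "span (M v (insert (\<pi> a) S) Y') = span (M v S Y')"
        unfolding span_eq by (auto simp: M_def intro: span_base)
      moreover have "span (M v' S Y) = span (M v S Y')"
        unfolding M_insert using True by (rule span_redundant)
      ultimately have "dim (M v (insert (\<pi> a) S) Y') = dim (M v' S Y)"
        by (intro span_eq_dim) simp
      moreover obtain T where T: "insert (\<pi> a) S \<subseteq> T" "T \<subseteq> E"
        "dim (\<Union>e\<in>T. L e) + card {a \<in> Y'. \<pi> a \<notin> T} \<le> dim (M v (insert (\<pi> a) S) Y')"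
        using IH[of Y' "insert (\<pi> a) S"] Y'(1) S \<pi>a by auto
      moreover have "{b \<in> Y. \<pi> b \<notin> T} = {b \<in> Y'. \<pi> b \<notin> T}"
        using T(1) Y'(2) by auto
      ultimately show ?thesis by (intro exI[of _ T]) simp
    next
      case False
      obtain T where T: "S \<subseteq> T" "T \<subseteq> E"
        "dim (\<Union>e\<in>T. L e) + card {a \<in> Y'. \<pi> a \<notin> T} \<le> dim (M v S Y')"
        using IH[OF Y'(1) S] by blast
      have "card {b \<in> Y. \<pi> b \<notin> T} \<le> card (insert a {b \<in> Y'. \<pi> b \<notin> T})"
        using Y' by (intro card_mono) auto
      also have "\<dots> \<le> card {b \<in> Y'. \<pi> b \<notin> T} + 1"
        using card_insert_le_m1 Y'(4) by (simp add: card_insert_if)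
      finally show ?thesis
        using T dim_insert_new[OF M_findim[OF S Y'(1)] False]
        by (intro exI[of _ T]) (simp add: M_insert)
    qed
  qed
  moreover have "\<forall>b\<in>insert a A. v' b \<in> L (\<pi> b)"
    using v w by (simp add: v'_def)
  ultimately show ?case
    unfolding M_def by blast
qed auto

end


section \<open>Representations of the natural polymatroid\<close>

definition polymatroid_representation ::
  "('k::field \<Rightarrow> 'v::ab_group_add \<Rightarrow> 'v) \<Rightarrow> 'e set \<Rightarrow> ('e set \<Rightarrow> int) \<Rightarrow> ('e \<Rightarrow> 'v set) \<Rightarrow> bool" where
  "polymatroid_representation scale E f L \<longleftrightarrow>
     (\<forall>e\<in>E. findim_subspace scale (L e)) \<and>
     (\<forall>S. S \<subseteq> E \<longrightarrow> f S = int (vector_space.dim scale (\<Union>e\<in>S. L e)))"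

lemma join_apply_cases:
  assumes "finite S"
  shows "join S i = 0 \<or> (i, join S i) \<in> S"
proof (rule ccontr)
  assume *: "\<not> ?thesis"
  have "join S \<le> (join S)(i := join S i - 1)"
    unfolding join_le_iff[OF assms]
  proof safe
    fix j t assume jt: "(j, t) \<in> S"
    then have "t \<le> join S j"
      using join_le_iff[OF assms, of "join S"] by blast
    with jt * show "t \<le> ((join S)(i := join S i - 1)) j"
      by (cases "t = join S j") auto
  qed
  then have "join S i \<le> join S i - 1"
    by (auto dest: le_funD[of _ _ i])
  with * show False by auto
qed

lemma join_graph:
  assumes "x \<in> hypercuboid m \<rho>"
  shows "join ((\<lambda>i. (i, x i)) ` {1..m}) = x"
proof (rule antisym)
  show "join ((\<lambda>i. (i, x i)) ` {1..m}) \<le> x"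
    by (subst join_le_iff) auto
  show "x \<le> join ((\<lambda>i. (i, x i)) ` {1..m})"
  proof (rule le_funI)
    fix i
    show "x i \<le> join ((\<lambda>i. (i, x i)) ` {1..m}) i"
    proof (cases "i \<in> {1..m}")
      case True
      then show ?thesis
        using join_le_iff[of "(\<lambda>i. (i, x i)) ` {1..m}" "join ((\<lambda>i. (i, x i)) ` {1..m})"] by auto
    next
      case False
      then show ?thesis using assms by (simp add: hypercuboid_def)
    qed
  qed
qed

lemma join_singleton: "join {(i, t)} = axis_point i t"
proof (rule antisym)
  show "join {(i, t)} \<le> axis_point i t"
    by (subst join_le_iff) (auto simp: axis_point_def)
  show "axis_point i t \<le> join {(i, t)}"
    using join_le_iff[of "{(i, t)}" "join {(i, t)}"] by (auto simp: axis_point_def le_fun_def)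
qed


section \<open>The natural polymatroid and the natural matroid\<close>

context matricube
begin

text \<open>
  The copies of the elements are placed generically in the subspaces.  If \<open>natural_rank\<close> says
  that \<open>Y\<close> is independent, then the dimension formula for generic vectors, with \<open>S\<close> empty,
  bounds the dimension of the span of \<open>Y\<close> from below by one of the terms in the minimum that
  defines \<open>natural_rank\<close>.  Conversely, at most \<open>polymatroid_rank r S\<close> independent
  vectors lie in the sum of the subspaces of \<open>S\<close>.
\<close>

lemma generic_vectors_represent_natural_matroid:
  fixes scale :: "'k::field \<Rightarrow> 'v::ab_group_add \<Rightarrow> 'v"
  assumes "vector_space scale" and "infinite (UNIV :: 'k set)"
    and rep: "polymatroid_representation scale (polymatroid_ground m \<rho>) (polymatroid_rank r) L"
  shows "\<exists>v. vector_representation scale (natural_ground m \<rho> r) (natural_rank m \<rho> r) v"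
proof -
  interpret vector_space scale by fact
  define E where "E = polymatroid_ground m \<rho>"
  define A where "A = natural_ground m \<rho> r"
  have E: "finite E" unfolding E_def by (rule finite_polymatroid_ground)
  have A: "finite A" "fst ` A \<subseteq> E"
    unfolding A_def E_def using natural_matroid(1) by (auto simp: natural_ground_def blow_up_def)
  have L: "\<And>e. e \<in> E \<Longrightarrow> findim_subspace scale (L e)"
    and rk: "\<And>S. S \<subseteq> E \<Longrightarrow> polymatroid_rank r S = int (dim (\<Union>e\<in>S. L e))"
    using rep by (auto simp: polymatroid_representation_def E_def)
  obtain v where v_generic: "(\<forall>a\<in>A. v a \<in> L (fst a)) \<and>
    (\<forall>Y S. Y \<subseteq> A \<longrightarrow> S \<subseteq> E \<longrightarrow> (\<exists>T. S \<subseteq> T \<and> T \<subseteq> E \<and>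
       dim (\<Union>e\<in>T. L e) + card {a \<in> Y. fst a \<notin> T} \<le> dim ((\<Union>e\<in>S. L e) \<union> v ` Y)))"
    using generic_vectors_exist[where \<pi> = fst and L = L, OF assms(2) E L A] ..
  then have v: "\<And>a. a \<in> A \<Longrightarrow> v a \<in> L (fst a)" by simp
  have "natural_rank m \<rho> r Y = int (card Y) \<longleftrightarrow> independent_family scale v Y" if Y: "Y \<subseteq> A" for Y
  proof -
    have finY: "finite Y" using Y A(1) finite_subset by blast
    have not_copies: "Y - blow_up r T = {a \<in> Y. fst a \<notin> T}" for T
      using Y by (auto simp: A_def natural_ground_def blow_up_def)
    show ?thesis
      unfolding independent_family_iff_dim[OF finY]
    proof
      assume eq: "natural_rank m \<rho> r Y = int (card Y)"
      obtain T where T: "T \<subseteq> E"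
        "dim (\<Union>e\<in>T. L e) + card {a \<in> Y. fst a \<notin> T} \<le> dim (v ` Y)"
        using v_generic[THEN conjunct2, rule_format, OF Y, of "{}"] by auto
      then have "card Y \<le> dim (v ` Y)"
        using natural_rank_le[of T Y] rk[OF T(1)] eq by (simp add: E_def not_copies)
      moreover have "dim (v ` Y) \<le> card Y"
        using dim_le_card'[of "v ` Y"] card_image_le[OF finY, of v] finY by simp
      ultimately show "dim (v ` Y) = card Y" by simp
    next
      assume eq: "dim (v ` Y) = card Y"
      obtain S where S: "S \<subseteq> E"
        "natural_rank m \<rho> r Y = polymatroid_rank r S + int (card (Y - blow_up r S))"
        unfolding E_def by (rule natural_rank_attained)
      let ?Z = "Y \<inter> blow_up r S"
      have "independent_family scale v Y"
        using eq independent_family_iff_dim[OF finY] by simp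
      then have "independent_family scale v ?Z"
        unfolding independent_family_def
        using inj_on_subset[of v Y ?Z] independent_mono[of "v ` Y" "v ` ?Z"] by blast
      then have "card ?Z = dim (v ` ?Z)"
        using independent_family_iff_dim[of ?Z v] finY by simp
      also have "\<dots> \<le> dim (span (\<Union>e\<in>S. L e))"
      proof (rule findim_dim_mono)
        show "findim_subspace scale (span (\<Union>e\<in>S. L e))"
          using S(1) L E finite_subset by (intro findim_subspace_span_UN) auto
        show "v ` ?Z \<subseteq> span (\<Union>e\<in>S. L e)"
        proof (rule image_subsetI)
          fix a assume "a \<in> ?Z"
          then have "v a \<in> L (fst a)" "fst a \<in> S"
            using v Y by (auto simp: blow_up_def)
          then show "v a \<in> span (\<Union>e\<in>S. L e)"
            by (intro span_base) blast
        qed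
      qed
      finally have "int (card ?Z) \<le> polymatroid_rank r S"
        using rk[OF S(1)] by simp
      moreover have "card Y = card ?Z + card (Y - blow_up r S)"
        using card_Int_Diff[OF finY] .
      ultimately have "int (card Y) \<le> natural_rank m \<rho> r Y"
        using S(2) by simp
      with natural_matroid(3)[of Y] show "natural_rank m \<rho> r Y = int (card Y)" by simp
    qed
  qed
  then show ?thesis
    unfolding vector_representation_def A_def by blast
qed

lemma polymatroid_rank_Un_le:
  assumes "S \<subseteq> polymatroid_ground m \<rho>" "T \<subseteq> polymatroid_ground m \<rho>"
  shows "polymatroid_rank r (S \<union> T) \<le> polymatroid_rank r T + int (card (blow_up r (S - T)))"
proof -
  have finS: "finite S"
    using assms finite_polymatroid_ground finite_subset by blast
  have "polymatroid_rank r (T \<union> D) \<le> polymatroid_rank r T + int (card (blow_up r D))"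
    if "D \<subseteq> S - T" "finite D" for D
    using that(2,1)
  proof (induction D rule: finite_induct)
    case empty
    show ?case by simp
  next
    case (insert e D)
    have sub: "T \<union> D \<subseteq> polymatroid_ground m \<rho>" "{e} \<subseteq> polymatroid_ground m \<rho>"
      using insert.prems assms by auto
    have "card (blow_up r (insert e D)) = card (blow_up r {e}) + card (blow_up r D)"
      using insert.hyps by (simp add: blow_up_def)
    moreover have "int (card (blow_up r {e})) = polymatroid_rank r {e}"
      using polymatroid_rank_nonneg[OF sub(2)] by (simp add: blow_up_def)
    moreover have "polymatroid_rank r (T \<union> insert e D) \<le> polymatroid_rank r (T \<union> D) + polymatroid_rank r {e}"
      using polymatroid_rank_submodular[OF sub] polymatroid_rank_nonneg[of "(T \<union> D) \<inter> {e}"] sub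
      by (simp add: subset_iff)
    ultimately show ?case
      using insert by simp
  qed
  from this[of "S - T"] finS show ?thesis
    by (simp add: Un_commute)
qed

text \<open>
  Taking \<open>S\<close> itself in the minimum gives one inequality.  For any other \<open>T\<close>, the rank that \<open>T\<close>
  lacks in comparison with \<open>S \<union> T\<close> is made up for by the copies of the elements of \<open>S - T\<close>.
\<close>

lemma natural_rank_blow_up:
  assumes "S \<subseteq> polymatroid_ground m \<rho>"
  shows "natural_rank m \<rho> r (blow_up r S) = polymatroid_rank r S"
proof (rule antisym)
  show "natural_rank m \<rho> r (blow_up r S) \<le> polymatroid_rank r S"
    using natural_rank_le[OF assms, of "blow_up r S"] by simp
  obtain T where T: "T \<subseteq> polymatroid_ground m \<rho>"
    "natural_rank m \<rho> r (blow_up r S) = polymatroid_rank r T + int (card (blow_up r S - blow_up r T))"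
    by (rule natural_rank_attained)
  have "blow_up r S - blow_up r T = blow_up r (S - T)"
    by (auto simp: blow_up_def)
  then have "polymatroid_rank r (S \<union> T) \<le> natural_rank m \<rho> r (blow_up r S)"
    using T polymatroid_rank_Un_le[OF assms T(1)] by simp
  moreover have "polymatroid_rank r S \<le> polymatroid_rank r (S \<union> T)"
    using assms T(1) by (intro polymatroid_rank_mono) auto
  ultimately show "polymatroid_rank r S \<le> natural_rank m \<rho> r (blow_up r S)" by simp
qed

end

text \<open>
  Rank functions of matroids are determined by their independent sets: a maximal independent
  subset \<open>I\<close> of \<open>Y\<close> has the rank of \<open>Y\<close>, and its vectors span those of \<open>Y\<close>.
\<close>

lemma matroid_rank_eq_dim:
  fixes scale :: "'k::field \<Rightarrow> 'v::ab_group_add \<Rightarrow> 'v" and rk :: "'e set \<Rightarrow> int"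
  assumes "vector_space scale" and rep: "vector_representation scale E rk v" and "finite E"
    and nonneg: "\<And>Y. 0 \<le> rk Y" and le_card: "\<And>Y. rk Y \<le> int (card Y)"
    and mono: "\<And>Y Z. \<lbrakk>Y \<subseteq> Z; Z \<subseteq> E\<rbrakk> \<Longrightarrow> rk Y \<le> rk Z"
    and submod: "\<And>Y Z. \<lbrakk>Y \<subseteq> E; Z \<subseteq> E\<rbrakk> \<Longrightarrow> rk (Y \<union> Z) + rk (Y \<inter> Z) \<le> rk Y + rk Z"
    and Y: "Y \<subseteq> E"
  shows "rk Y = int (vector_space.dim scale (v ` Y))"
proof -
  interpret vector_space scale by fact
  have fin: "finite X" if "X \<subseteq> Y" for X
    using that Y \<open>finite E\<close> by (meson finite_subset)
  define \<I> where "\<I> = {X. X \<subseteq> Y \<and> rk X = int (card X)}"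
  have "{} \<in> \<I>"
    using nonneg[of "{}"] le_card[of "{}"] by (simp add: \<I>_def)
  moreover have "finite \<I>"
    using fin[OF order_refl] by (simp add: \<I>_def)
  ultimately obtain I where "I \<in> \<I>" and max: "\<And>X. \<lbrakk>X \<in> \<I>; I \<subseteq> X\<rbrakk> \<Longrightarrow> X = I"
    using finite_has_maximal2[of \<I> "{}"] by metis
  then have I: "I \<subseteq> Y" "rk I = int (card I)" by (auto simp: \<I>_def)
  have step: "rk (insert y I) \<noteq> int (card (insert y I))" if "y \<in> Y - I" for y
    using max[of "insert y I"] that I(1) by (auto simp: \<I>_def)
  have indep_iff: "rk X = int (card X) \<longleftrightarrow> dim (v ` X) = card X" if "X \<subseteq> Y" for X
    using rep that Y independent_family_iff_dim[OF fin[OF that]]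
    by (auto simp: vector_representation_def)
  have "rk (I \<union> D) \<le> rk I" if "D \<subseteq> Y - I" "finite D" for D
    using that(2,1)
  proof (induction D rule: finite_induct)
    case (insert y D)
    then have y: "y \<in> Y - I" "y \<notin> I \<union> D" by auto
    have "rk (insert y I) \<le> rk I"
      using step[OF y(1)] le_card[of "insert y I"] I fin[OF I(1)] y by simp
    moreover have "rk ((I \<union> D) \<union> insert y I) + rk ((I \<union> D) \<inter> insert y I) \<le> rk (I \<union> D) + rk (insert y I)"
      using I(1) insert.prems Y by (intro submod) auto
    moreover have "(I \<union> D) \<union> insert y I = I \<union> insert y D" "(I \<union> D) \<inter> insert y I = I"
      using y by auto
    ultimately show ?case using insert by simp
  qed simp
  from this[of "Y - I"] have "rk Y \<le> rk I"
    using fin I(1) by (simp add: Un_absorb1)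
  then have "rk Y = int (card I)"
    using mono[OF I(1) Y] I(2) by simp
  moreover have "dim (v ` I) = card I"
    using indep_iff[OF I(1)] I(2) by simp
  moreover have "dim (v ` Y) = dim (v ` I)"
  proof (rule span_eq_dim)
    have "v y \<in> span (v ` I)" if "y \<in> Y" for y
    proof (rule ccontr)
      assume new: "v y \<notin> span (v ` I)"
      then have y: "y \<in> Y - I" using that span_base by blast
      have "dim (insert (v y) (v ` I)) = dim (v ` I) + 1"
        using new fin[OF I(1)] by (intro dim_insert_new findim_subspace_span) auto
      then have "dim (v ` insert y I) = card (insert y I)"
        using \<open>dim (v ` I) = card I\<close> y fin[OF I(1)] by simp
      then show False
        using step[OF y] indep_iff[of "insert y I"] I(1) y by auto
    qed
    then show "span (v ` Y) = span (v ` I)"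
      unfolding span_eq using I(1) span_base by blast
  qed
  ultimately show ?thesis by simp
qed

context matricube
begin

lemma spans_of_copies_represent_polymatroid:
  fixes scale :: "'k::field \<Rightarrow> 'v::ab_group_add \<Rightarrow> 'v"
  assumes "vector_space scale"
    and "vector_representation scale (natural_ground m \<rho> r) (natural_rank m \<rho> r) v"
  shows "polymatroid_representation scale (polymatroid_ground m \<rho>) (polymatroid_rank r)
    (\<lambda>e. module.span scale (v ` blow_up r {e}))"
proof -
  interpret vector_space scale by fact
  have "polymatroid_rank r S = int (dim (\<Union>e\<in>S. span (v ` blow_up r {e})))"
    if S: "S \<subseteq> polymatroid_ground m \<rho>" for S
  proof -
    have "blow_up r S \<subseteq> natural_ground m \<rho> r"
      using S by (auto simp: natural_ground_def blow_up_def)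
    then have "natural_rank m \<rho> r (blow_up r S) = int (dim (v ` blow_up r S))"
      using matroid_rank_eq_dim[OF assms natural_matroid] by blast
    moreover have "span (\<Union>e\<in>S. span (v ` blow_up r {e})) = span (v ` blow_up r S)"
    proof (rule antisym)
      have "span (v ` blow_up r {e}) \<subseteq> span (v ` blow_up r S)" if "e \<in> S" for e
        using that by (intro span_mono image_mono) (auto simp: blow_up_def)
      then show "span (\<Union>e\<in>S. span (v ` blow_up r {e})) \<subseteq> span (v ` blow_up r S)"
        by (intro span_minimal) auto
      have "v ` blow_up r S \<subseteq> (\<Union>e\<in>S. v ` blow_up r {e})"
        by (auto simp: blow_up_def)
      also have "\<dots> \<subseteq> (\<Union>e\<in>S. span (v ` blow_up r {e}))"
        by (intro UN_mono span_superset order_refl)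
      finally show "span (v ` blow_up r S) \<subseteq> span (\<Union>e\<in>S. span (v ` blow_up r {e}))"
        by (rule span_mono)
    qed
    ultimately show ?thesis
      using natural_rank_blow_up[OF S] span_eq_dim[of "\<Union>e\<in>S. span (v ` blow_up r {e})"] by simp
  qed
  then show ?thesis
    unfolding polymatroid_representation_def
    by (auto simp: blow_up_def intro!: findim_subspace_span)
qed

end


section \<open>The natural polymatroid and flags\<close>

lemma initial_flag_antimono:
  assumes "initial_flag scale H s F" "t \<le> u" "u \<le> s"
  shows "F u \<subseteq> F t"
  using assms(2,3)
proof (induction u rule: dec_induct)
  case (step u)
  have "F (Suc u) \<subseteq> F u"
    using assms(1) step.prems by (auto simp: initial_flag_def dest!: bspec[of _ _ "Suc u"])
  with step show ?case by auto
qed simp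

context matricube
begin

text \<open>
  For a set \<open>S\<close> of elements, the intersection of the members of the flags that belong to \<open>S\<close> is
  the one belonging to the point \<open>join S\<close>: on each axis the largest element of \<open>S\<close> determines it.
\<close>

lemma annihilators_of_flags_represent_polymatroid:
  fixes scale :: "'k::field \<Rightarrow> 'v::ab_group_add \<Rightarrow> 'v"
  assumes "vector_space scale" and "m \<ge> 1" and rep: "flag_representation scale m \<rho> r H F"
  shows "polymatroid_representation functional_scale (polymatroid_ground m \<rho>) (polymatroid_rank r)
    (\<lambda>e. annihilator scale H (F (fst e) (snd e)))"
proof -
  interpret vector_space scale by fact
  have H: "findim_subspace scale H"
    and flag: "\<And>i. i \<in> {1..m} \<Longrightarrow> initial_flag scale H (\<rho> i) (F i)"
    and rk: "\<And>x. x \<in> hypercuboid m \<rho> \<Longrightarrow> r x = codim scale H (\<Inter>i\<in>{1..m}. F i (x i))"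
    using rep by (auto simp: flag_representation_def)
  have F0: "F i 0 = H" if "i \<in> {1..m}" for i
    using flag[OF that] by (simp add: initial_flag_def)
  have F: "subspace (F i t) \<and> F i t \<subseteq> H" if "i \<in> {1..m}" "t \<le> \<rho> i" for i t
    using initial_flag_antimono[OF flag[OF that(1)], of 0 t] that flag[OF that(1)]
    by (simp add: initial_flag_def)
  have "polymatroid_rank r S = int (functional.dim (\<Union>e\<in>S. annihilator scale H (F (fst e) (snd e))))"
    if S: "S \<subseteq> polymatroid_ground m \<rho>" for S
  proof -
    have finS: "finite S"
      using S finite_polymatroid_ground finite_subset by blast
    have ground: "i \<in> {1..m} \<and> t \<le> \<rho> i" if "(i, t) \<in> S" for i t
      using that S by (auto simp: polymatroid_ground_def)
    have hyp: "join S \<in> hypercuboid m \<rho>"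
      using S by (rule join_in_hypercuboid)
    have "H \<inter> (\<Inter>e\<in>S. F (fst e) (snd e)) = (\<Inter>i\<in>{1..m}. F i (join S i))"
    proof (rule antisym)
      have "H \<inter> (\<Inter>e\<in>S. F (fst e) (snd e)) \<subseteq> F i (join S i)" if "i \<in> {1..m}" for i
        using join_apply_cases[OF finS, of i] F0[OF that] by force
      then show "H \<inter> (\<Inter>e\<in>S. F (fst e) (snd e)) \<subseteq> (\<Inter>i\<in>{1..m}. F i (join S i))"
        by blast
      have F_join: "F i (join S i) \<subseteq> F i t" if "(i, t) \<in> S" for i t
      proof (rule initial_flag_antimono)
        show "initial_flag scale H (\<rho> i) (F i)"
          using flag ground[OF that] by blast
        show "t \<le> join S i"
          using that join_le_iff[OF finS, of "join S"] by auto
        show "join S i \<le> \<rho> i"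
          using hyp ground[OF that] by (simp add: hypercuboid_def)
      qed
      have "(\<Inter>i\<in>{1..m}. F i (join S i)) \<subseteq> F (fst e) (snd e)" if "e \<in> S" for e
      proof -
        have e: "(fst e, snd e) \<in> S" using that by simp
        then show ?thesis
          using F_join[OF e] ground[OF e] by blast
      qed
      moreover have "(\<Inter>i\<in>{1..m}. F i (join S i)) \<subseteq> H"
      proof -
        have one: "1 \<in> {1..m}" using \<open>m \<ge> 1\<close> by simp
        then have "join S 1 \<le> \<rho> 1" using hyp by (simp add: hypercuboid_def)
        then have "F 1 (join S 1) \<subseteq> H" using F[OF one] by blast
        with one show ?thesis by blast
      qed
      ultimately show "(\<Inter>i\<in>{1..m}. F i (join S i)) \<subseteq> H \<inter> (\<Inter>e\<in>S. F (fst e) (snd e))"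
        by blast
    qed
    then have "functional.dim (\<Union>e\<in>S. annihilator scale H (F (fst e) (snd e)))
        + dim (\<Inter>i\<in>{1..m}. F i (join S i)) = dim H"
      using dim_UN_annihilator[OF H, of S "\<lambda>e. F (fst e) (snd e)"] F ground by auto
    then show ?thesis
      using rk[OF hyp] by (simp add: polymatroid_rank_def codim_def)
  qed
  moreover have "findim_subspace functional_scale (annihilator scale H U)" for U
    by (rule functional.findim_subspace_subset[OF findim_dual[OF H] subspace_annihilator])
       (auto simp: annihilator_def)
  ultimately show ?thesis
    unfolding polymatroid_representation_def by blast
qed

text \<open>
  The subspaces representing the elements \<open>(i, 0), (i, 1), \<dots>\<close> grow, since the rank of two of
  them together is the rank of the larger one.  Their annihilators therefore decrease.  The
  vector \<open>w\<close> enlarges the ambient space by one dimension; the functional that vanishes on all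
  the subspaces but not at \<open>w\<close> keeps the flags from ending in \<open>0\<close>.
\<close>

lemma annihilators_of_polymatroid_represent_matricube:
  fixes scale :: "'k::field \<Rightarrow> 'v::ab_group_add \<Rightarrow> 'v"
  assumes "vector_space scale" and "m \<ge> 1"
    and rep: "polymatroid_representation scale (polymatroid_ground m \<rho>) (polymatroid_rank r) L"
    and w: "w \<notin> module.span scale (\<Union>e\<in>polymatroid_ground m \<rho>. L e)"
  shows "matricube_representable TYPE('k) m \<rho> r"
proof -
  interpret vector_space scale by fact
  define E where "E = polymatroid_ground m \<rho>"
  define W where "W = span (\<Union>e\<in>E. L e)"
  define H where "H = span (insert w W)"
  define F where "F i t = annihilator scale H (L (i, t))" for i t
  have L: "\<And>e. e \<in> E \<Longrightarrow> findim_subspace scale (L e)"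
    and rk: "\<And>S. S \<subseteq> E \<Longrightarrow> polymatroid_rank r S = int (dim (\<Union>e\<in>S. L e))"
    using rep by (auto simp: polymatroid_representation_def E_def)
  have LE: "(i, t) \<in> E" if "i \<in> {1..m}" "t \<le> \<rho> i" for i t
    using that by (simp add: E_def polymatroid_ground_def)
  have subL: "subspace (L e)" if "e \<in> E" for e
    using L[OF that] by (rule findim_subspace_imp_subspace)
  have "findim_subspace scale W"
    unfolding W_def E_def using L finite_polymatroid_ground
    by (intro findim_subspace_span_UN) (auto simp: E_def)
  then obtain B where "finite B" "span B = W" "card B = dim W"
    using findim_basis by blast
  then have H: "findim_subspace scale H"
    using findim_subspace_span[of "insert w B"] by (simp add: H_def span_insert) (metis span_eq_iff span_span)
  have subH: "subspace H" by (simp add: H_def)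
  have WH: "W \<subseteq> H" "subspace W" "w \<in> H" "w \<notin> W"
    using w span_superset by (auto simp: H_def W_def E_def intro: span_base)
  have LW: "L e \<subseteq> W" if "e \<in> E" for e
    unfolding W_def using that span_superset by blast
  have LH: "L e \<subseteq> H" if "e \<in> E" for e
    using LW[OF that] WH(1) by blast
  have rk_axis: "r (axis_point i t) = int (dim (L (i, t)))" if "i \<in> {1..m}" "t \<le> \<rho> i" for i t
    using rk[of "{(i, t)}"] LE[OF that] by (simp add: polymatroid_rank_def join_singleton)
  have L0: "L (i, 0) = {0}" if "i \<in> {1..m}" for i
  proof -
    have "axis_point i 0 = (\<lambda>_. 0)" by (simp add: axis_point_def fun_eq_iff)
    then have "dim (L (i, 0)) = 0"
      using rk_axis[OF that, of 0] rank_zero by simp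
    then show ?thesis
      using findim_dim_eqD[of "L (i, 0)" "{0}"] L subL subspace_0 LE[OF that] by simp
  qed
  have L_mono: "L (i, t - 1) \<subseteq> L (i, t)" if i: "i \<in> {1..m}" and t: "t \<le> \<rho> i" for i t
  proof -
    let ?S = "{(i, t - 1), (i, t)}"
    have S: "?S \<subseteq> E" using LE i t by simp
    have "join ?S = sup (axis_point i (t - 1)) (axis_point i t)"
      using join_Un[of "{(i, t - 1)}" "{(i, t)}"] by (simp add: join_singleton insert_commute)
    also have "\<dots> = axis_point i t"
      by (rule sup_absorb2) (auto simp: axis_point_def le_fun_def)
    finally have "dim (L (i, t - 1) \<union> L (i, t)) = dim (L (i, t))"
      using rk[OF S] rk_axis[OF i t] by (simp add: polymatroid_rank_def)
    moreover have "findim_subspace scale (span (\<Union>e\<in>?S. L e))"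
      using L S by (intro findim_subspace_span_UN) auto
    then have "findim_subspace scale (span (L (i, t - 1) \<union> L (i, t)))"
      by simp
    ultimately have "L (i, t) = span (L (i, t - 1) \<union> L (i, t))"
      using subL S span_superset[of "L (i, t - 1) \<union> L (i, t)"] by (intro findim_dim_eqD) auto
    then show ?thesis
      using span_superset[of "L (i, t - 1) \<union> L (i, t)"] by blast
  qed
  have "dim {0} = 0"
    using dim_span[of "{}"] dim_eq_card_independent[OF independent_empty] by simp
  then have dim_dual: "functional.dim (dual scale H) = dim H"
    using dim_annihilator[OF H, of "{0}"] annihilator_zero[OF subH] subspace_0[OF subH] by simp
  have "flag_representation functional_scale m \<rho> r (dual scale H) F"
    unfolding flag_representation_def
  proof (intro conjI ballI)
    show "findim_subspace functional_scale (dual scale H)"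
      using H by (rule findim_dual)
  next
    fix i assume i: "i \<in> {1..m}"
    have "F i t \<subseteq> F i (t - 1) \<and> codim functional_scale (F i (t - 1)) (F i t) \<in> {0, 1}"
      if t: "t \<in> {1..\<rho> i}" for t
    proof
      have t': "t \<le> \<rho> i" "t - 1 \<le> \<rho> i" using t by auto
      show "F i t \<subseteq> F i (t - 1)"
        unfolding F_def by (rule annihilator_antimono[OF L_mono[OF i t'(1)]])
      have "functional.dim (F i u) + dim (L (i, u)) = dim H" if "u \<le> \<rho> i" for u
        unfolding F_def using LE[OF i that] by (intro dim_annihilator H subL LH)
      from this[OF t'(1)] this[OF t'(2)]
      have "codim functional_scale (F i (t - 1)) (F i t) = r (axis_point i t) - r (axis_point i (t - 1))"
        using rk_axis[OF i t'(1)] rk_axis[OF i t'(2)] by (simp add: codim_def)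
      moreover have "dim (L (i, t - 1)) \<le> dim (L (i, t))"
        using findim_dim_mono[OF L[OF LE[OF i t'(1)]] L_mono[OF i t'(1)]] .
      ultimately show "codim functional_scale (F i (t - 1)) (F i t) \<in> {0, 1}"
        using rank_step[OF i t] rk_axis[OF i t'(1)] rk_axis[OF i t'(2)] by auto
    qed
    moreover have "{0} \<subset> F i (\<rho> i)"
    proof -
      obtain g where g: "g \<in> annihilator scale H W" "g w \<noteq> 0"
        using annihilator_separates[OF H WH(2,1,3,4)] .
      have "g \<in> F i (\<rho> i)"
        unfolding F_def using annihilator_antimono[OF LW[OF LE[OF i order_refl]]] g(1) by blast
      moreover have "g \<noteq> 0" using g(2) by auto
      moreover have "0 \<in> F i (\<rho> i)"
        unfolding F_def by (rule functional.subspace_0[OF subspace_annihilator])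
      ultimately show ?thesis by blast
    qed
    moreover have "F i 0 = dual scale H"
      unfolding F_def L0[OF i] by (rule annihilator_zero[OF subH])
    ultimately show "initial_flag functional_scale (dual scale H) (\<rho> i) (F i)"
      unfolding initial_flag_def F_def using subspace_annihilator by blast
  next
    fix x assume x: "x \<in> hypercuboid m \<rho>"
    let ?S = "(\<lambda>i. (i, x i)) ` {1..m}"
    have S: "?S \<subseteq> E"
      using x LE by (auto simp: hypercuboid_def)
    have UH: "(\<Union>e\<in>?S. L e) \<subseteq> H" using LH S by blast
    have "(\<Inter>i\<in>{1..m}. F i (x i)) = annihilator scale H (\<Union>e\<in>?S. L e)"
      unfolding F_def annihilator_def using \<open>m \<ge> 1\<close> by force
    also have "\<dots> = annihilator scale H (span (\<Union>e\<in>?S. L e))"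
      using annihilator_span[OF subH UH] by simp
    finally have "functional.dim (\<Inter>i\<in>{1..m}. F i (x i)) + dim (\<Union>e\<in>?S. L e) = dim H"
      using dim_annihilator[OF H, of "span (\<Union>e\<in>?S. L e)"] span_minimal[OF UH subH] by simp
    moreover have "r x = int (dim (\<Union>e\<in>?S. L e))"
      using rk[OF S] join_graph[OF x] by (simp add: polymatroid_rank_def)
    ultimately show "r x = codim functional_scale (dual scale H) (\<Inter>i\<in>{1..m}. F i (x i))"
      by (simp add: codim_def dim_dual)
  qed
  then show ?thesis
    by (rule matricube_representableI[OF functional.vector_space_axioms \<open>m \<ge> 1\<close>])
qed

end

text \<open>
  The unit sequences are independent, so no finite set spans the space of sequences.
\<close>

lemma findim_subspace_of_sequences_proper:
  assumes "findim_subspace (seq_scale :: 'k::field \<Rightarrow> _) U"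
  shows "\<exists>w. w \<notin> U"
proof (rule ccontr)
  assume "\<nexists>w. w \<notin> U"
  then obtain B where B: "finite B" "functional.span B = (UNIV :: (nat \<Rightarrow> 'k) set)"
    using assms unfolding findim_subspace_def seq_scale_eq by auto
  define c where "c j = (\<lambda>n::nat. if n = j then 1 else 0 :: 'k)" for j
  have "inj_on c {..card B}" "functional.independent (c ` {..card B})"
    by (rule biorthogonal_independent[of _ c id]; auto simp: c_def)+
  moreover from this have "card (c ` {..card B}) \<le> card B"
    using functional.independent_span_bound[OF B(1)] B(2) by blast
  ultimately show False by (simp add: card_image)
qed

theorem theorem9p1:
  fixes m :: nat and \<rho> :: "nat \<Rightarrow> nat" and r :: "(nat \<Rightarrow> nat) \<Rightarrow> int"
  assumes "infinite (UNIV :: 'k::field set)"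
    and "m \<ge> 1"
    and "matricube m \<rho> r"
  shows "matricube_representable TYPE('k) m \<rho> r \<longleftrightarrow>
         matroid_representable TYPE('k) (natural_ground m \<rho> r) (natural_rank m \<rho> r)"
proof -
  interpret matricube m \<rho> r by fact
  show ?thesis
  proof
    assume "matricube_representable TYPE('k) m \<rho> r"
    then obtain H F where "flag_representation (seq_scale :: 'k \<Rightarrow> _) m \<rho> r H F"
      unfolding matricube_representable_def by blast
    then have "polymatroid_representation functional_scale (polymatroid_ground m \<rho>)
        (polymatroid_rank r) (\<lambda>e. annihilator seq_scale H (F (fst e) (snd e)))"
      by (rule annihilators_of_flags_represent_polymatroid[OF seq.vector_space_axioms \<open>m \<ge> 1\<close>])
    then obtain v where "vector_representation (functional_scale :: 'k \<Rightarrow> ((nat \<Rightarrow> 'k) \<Rightarrow> 'k) \<Rightarrow> _)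
        (natural_ground m \<rho> r) (natural_rank m \<rho> r) v"
      using generic_vectors_represent_natural_matroid[OF functional.vector_space_axioms assms(1)] by blast
    then show "matroid_representable TYPE('k) (natural_ground m \<rho> r) (natural_rank m \<rho> r)"
      by (rule matroid_representableI[OF functional.vector_space_axioms natural_matroid(1)])
  next
    assume "matroid_representable TYPE('k) (natural_ground m \<rho> r) (natural_rank m \<rho> r)"
    then obtain L where L: "polymatroid_representation (seq_scale :: 'k \<Rightarrow> _)
        (polymatroid_ground m \<rho>) (polymatroid_rank r) L"
      unfolding matroid_representable_def
      using spans_of_copies_represent_polymatroid[OF seq.vector_space_axioms] by blast
    have "findim_subspace seq_scale (seq.span (\<Union>e\<in>polymatroid_ground m \<rho>. L e))"
      using L finite_polymatroid_ground
      by (intro seq.findim_subspace_span_UN) (auto simp: polymatroid_representation_def)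
    then obtain w where "w \<notin> seq.span (\<Union>e\<in>polymatroid_ground m \<rho>. L e)"
      using findim_subspace_of_sequences_proper by blast
    then show "matricube_representable TYPE('k) m \<rho> r"
      by (rule annihilators_of_polymatroid_represent_matricube[OF seq.vector_space_axioms \<open>m \<ge> 1\<close> L])
  qed
qed

end
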